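(* Let $n$ and $k$ be integers with $3\le k\le n-2$, and let $\mathscr{T}_n^k$ be the set of all $n$-vertex trees with exactly $k$ leaves. Let $r\in\{0,1,\ldots,k-1\}$ with $n-1\equiv r\pmod k$. Among all trees in $\mathscr{T}_n^k$, the balanced spider $S(\underbrace{\lceil\tfrac{n-1}{k}\rceil,\ldots,\lceil\tfrac{n-1}{k}\rceil}_{r},\underbrace{\lfloor\tfrac{n-1}{k}\rfloor,\ldots,\lfloor\tfrac{n-1}{k}\rfloor}_{k-r})$ minimizes the eccentric distance sum.
   Context: All graphs are simple and connected; a leaf is a vertex of degree 1. For a graph $G$ and vertices $u,v$, $d_G(u,v)$ is the distance; $D_G(v)=\sum_{u\in V_G}d_G(u,v)$; the eccentricity $\varepsilon_G(v)$ is the maximum distance from $v$ to any vertex. The eccentric distance sum is $\xi^d(G)=\sum_{v\in V_G}\varepsilon_G(v)D_G(v)$. For positive integers $a_1,\ldots,a_k$ with $\sum a_i=n-1$, the spider $S(a_1,\ldots,a_k)$ is the tree consisting of a vertex (the hub) and $k$ paths (legs) starting at the hub, pairwise sharing only the hub, where the $i$-th leg has length $a_i$. *)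

theory Defs
  imports
    Complex_Main
    "HOL-Number_Theory.Cong"
    "Graph_Theory.Digraph_Component"
    "Graph_Theory.Pair_Digraph"
begin

text \<open>
  Finite simple graphs are the symmetric loop-free digraphs of the locale \<^locale>\<open>pair_graph\<close>,
  each edge being a pair of opposite arcs.  Consequently the length of a walk is the length of its
  list of arcs, and the degree of a vertex is its out-degree.
\<close>

text \<open>
  The library predicates \<open>forest\<close> and \<open>tree\<close> treat \<open>u, v, u\<close> as a cycle, so no symmetric
  digraph with an edge satisfies them.  A cycle of a simple graph has length at least 3.
\<close>

definition simple_tree :: "'a pair_pre_digraph \<Rightarrow> bool" where
  "simple_tree G \<longleftrightarrow>
     pair_graph G \<and> Digraph_Component.connected (with_proj G) \<and>
     \<not> (\<exists>p. pre_digraph.cycle (with_proj G) p \<and> 3 \<le> length p)"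

definition leaves :: "'a pair_pre_digraph \<Rightarrow> 'a set" where
  "leaves G = {v \<in> pverts G. out_degree (with_proj G) v = 1}"

definition trees_with_leaves :: "nat \<Rightarrow> nat \<Rightarrow> 'a pair_pre_digraph set" where
  "trees_with_leaves n k = {G. simple_tree G \<and> card (pverts G) = n \<and> card (leaves G) = k}"

text \<open>The distance is meaningful only if \<open>v\<close> is reachable from \<open>u\<close>.\<close>

definition graph_dist :: "'a pair_pre_digraph \<Rightarrow> 'a \<Rightarrow> 'a \<Rightarrow> nat" where
  "graph_dist G u v = (LEAST l. \<exists>p. pre_digraph.awalk (with_proj G) u p v \<and> length p = l)"

definition dist_sum :: "'a pair_pre_digraph \<Rightarrow> 'a \<Rightarrow> nat" where
  "dist_sum G v = (\<Sum>u\<in>pverts G. graph_dist G u v)"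

definition eccentricity :: "'a pair_pre_digraph \<Rightarrow> 'a \<Rightarrow> nat" where
  "eccentricity G v = Max ((\<lambda>u. graph_dist G v u) ` pverts G)"

definition eccentric_distance_sum :: "'a pair_pre_digraph \<Rightarrow> nat" where
  "eccentric_distance_sum G = (\<Sum>v\<in>pverts G. eccentricity G v * dist_sum G v)"

text \<open>
  \<open>leg_vertex i j\<close> is the vertex at distance \<open>j\<close> from the hub \<open>(0, 0)\<close> on the \<open>i\<close>-th leg; all legs
  share their vertex with \<open>j = 0\<close>.
\<close>

definition leg_vertex :: "nat \<Rightarrow> nat \<Rightarrow> nat \<times> nat" where
  "leg_vertex i j = (if j = 0 then (0, 0) else (i, j))"

definition spider :: "nat list \<Rightarrow> (nat \<times> nat) pair_pre_digraph" where
  "spider as =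
     \<lparr> pverts = insert (0, 0) {leg_vertex i j | i j. i < length as \<and> j \<le> as ! i},
       parcs = {(leg_vertex i j, leg_vertex i (Suc j)) | i j. i < length as \<and> j < as ! i}
             \<union> {(leg_vertex i (Suc j), leg_vertex i j) | i j. i < length as \<and> j < as ! i} \<rparr>"

end

theory Submission
  imports Defs
begin

text \<open>
  Root a tree at a vertex \<open>c\<close> of minimal eccentricity \<open>R\<close>.  Two branches at \<open>c\<close> have heights \<open>R\<close>
  and \<open>R' \<in> {R - 1, R}\<close>, so all eccentricities are known in terms of depths.  Decompose
  the tree into at most \<open>k\<close> descending chains, two of which are deepest paths in these two branches, and
  hang every chain directly on \<open>c\<close>.  A vertex may move away from a chain it was attached to, but it gets
  closer to the long chain in the opposite branch by the same amount, and that chain is at least as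
  long and as heavy.  Hence the sum does not increase and a spider remains.  Moving end vertices from
  longer to shorter legs of the spider decreases the sum further until the legs are balanced.
\<close>

section \<open>Straightening a weighted tree\<close>

text \<open>The obstacle is that eccentricities change whenever the tree does. They are therefore
  frozen: each vertex gets a weight that depends only on its position in the spider and is at most
  its eccentricity in the tree, and both transformations act on weighted sums of distances. Only the
  balanced spider is compared with the weights again. If its longest leg has length
  \<open>q' \<le> R'\<close>, all weights can be lowered to \<open>q'\<close> plus depth, which
  still bounds its eccentricities. Otherwise the straightened spider is already the balanced one and
  the original weights serve. All estimates run one way: tree distances are bounded from below by
  ancestor sets, spider distances from above by explicit walks.\<close>

definition spider_verts :: "nat \<Rightarrow> (nat \<Rightarrow> nat) \<Rightarrow> (nat \<times> nat) set" where
  "spider_verts k l = insert (0, 0) (SIGMA i:{..<k}. {1..l i})"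

text \<open>The hub carries leg number 0. This is harmless, as both cases agree when one of the
  heights is 0.\<close>

fun spider_dist :: "nat \<times> nat \<Rightarrow> nat \<times> nat \<Rightarrow> nat" where
  "spider_dist (i, a) (i', b) = (if i = i' then (a - b) + (b - a) else a + b)"

lemma spider_dist_sym: "spider_dist x y = spider_dist y x"
  by (cases x; cases y) auto

lemma finite_spider_verts [simp]: "finite (spider_verts k l)"
  by (simp add: spider_verts_def)

lemma sum_spider_verts:
  fixes f :: "nat \<times> nat \<Rightarrow> 'b :: comm_monoid_add"
  shows "sum f (spider_verts k l) = f (0, 0) + (\<Sum>i<k. \<Sum>m=1..l i. f (i, m))"
proof -
  have "sum f (spider_verts k l) = f (0, 0) + sum f (SIGMA i:{..<k}. {1..l i})"
    unfolding spider_verts_def by (subst sum.insert) auto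
  also have "sum f (SIGMA i:{..<k}. {1..l i}) = (\<Sum>i<k. \<Sum>m=1..l i. f (i, m))"
    by (subst sum.Sigma) auto
  finally show ?thesis .
qed

text \<open>As the weight is symmetric, the losses at the two ends of a pair can each be charged to
  their own end.\<close>

lemma sum_symmetrize:
  fixes e :: "'a \<Rightarrow> nat"
  shows "(\<Sum>u\<in>V. \<Sum>v\<in>V. (e u + e v) * (f u v + f v u)) =
         2 * (\<Sum>u\<in>V. \<Sum>v\<in>V. (e u + e v) * f u v)"
proof -
  have "(\<Sum>u\<in>V. \<Sum>v\<in>V. (e u + e v) * f v u) = (\<Sum>u\<in>V. \<Sum>v\<in>V. (e u + e v) * f u v)"
    by (subst sum.swap) (simp add: add.commute)
  then show ?thesis
    by (simp add: distrib_left sum.distrib)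
qed

text \<open>
  The chains of a tree are numbered by \<open>i < k\<close>; \<open>t v\<close> is the chain of \<open>v\<close> and \<open>j i v\<close> the number of
  vertices of chain \<open>i\<close> on the path from the root \<open>c\<close> to \<open>v\<close>.  Hanging all chains directly on the root
  brings \<open>u\<close> closer to the root and to a long chain \<open>Q u\<close> in another branch by \<open>\<Sum>i\<noteq>t u. j i u\<close>, and
  increases its distance to the vertices of a chain \<open>i\<close> by at most \<open>j i u\<close>.  The assumption
  \<open>capacity\<close> says that chain \<open>Q u\<close> with the root outweighs chain \<open>i\<close>.
\<close>

lemma straighten_sum:
  fixes k :: nat and j :: "nat \<Rightarrow> 'a \<Rightarrow> nat" and t :: "'a \<Rightarrow> nat" and e :: "nat \<times> nat \<Rightarrow> nat"
  defines "\<phi> \<equiv> \<lambda>v. (t v, j (t v) v)"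
  defines "\<sigma> \<equiv> \<lambda>u v. \<Sum>i<k. (j i u - j i v) + (j i v - j i u)"
  assumes c: "c \<in> V" "t c = 0" "\<And>i. j i c = 0"
    and t: "\<And>v. v \<in> V \<Longrightarrow> t v < k"
    and bij: "bij_betw \<phi> V (spider_verts k l)"
    and Q: "\<And>v. v \<in> V \<Longrightarrow> Q v < 2 \<and> j (Q v) v * (\<Sum>i\<in>{..<k} - {t v}. j i v) = 0"
    and single: "\<And>v i. v \<in> V \<Longrightarrow> t v < 2 \<Longrightarrow> i < k \<Longrightarrow> i \<noteq> t v \<Longrightarrow> j i v = 0"
    and k: "2 \<le> k"
    and capacity: "\<And>u i. u \<in> V \<Longrightarrow> i < k \<Longrightarrow> i \<noteq> t u \<Longrightarrow> j i u > 0 \<Longrightarrow>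
        (\<Sum>m=1..l i. e (\<phi> u) + e (i, m)) \<le>
        e (\<phi> u) + e (0, 0) + (\<Sum>m=1..l (Q u). e (\<phi> u) + e (Q u, m))"
  shows "(\<Sum>x\<in>spider_verts k l. \<Sum>y\<in>spider_verts k l. e x * spider_dist x y)
           \<le> (\<Sum>u\<in>V. \<Sum>v\<in>V. e (\<phi> u) * \<sigma> u v)"
proof -
  \<comment> \<open>\<open>exc u\<close> is how far hanging lifts \<open>u\<close> towards the root.
    \<open>D u x\<close> bounds the loss charged to \<open>u\<close> at position \<open>x\<close>;
    \<open>G u x\<close> is the gain set against it, at the root and along chain
    \<open>Q u\<close>.\<close>
  define exc where "exc u = (\<Sum>i\<in>{..<k} - {t u}. j i u)" for u
  define D where "D u x = (if snd x > 0 \<and> fst x \<noteq> t u then j (fst x) u else 0)" for u and x :: "nat \<times> nat"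
  define G where "G u x = (if snd x = 0 \<or> fst x = Q u then exc u else 0)" for u and x :: "nat \<times> nat"
  define E where "E u = e (\<phi> u)" for u
  have phic: "\<phi> c = (0, 0)" using c by (simp add: \<phi>_def)
  have pos: "snd (\<phi> v) > 0" if "v \<in> V" "v \<noteq> c" for v
  proof -
    have "\<phi> v \<noteq> (0,0)" using that bij phic c(1) by (metis bij_betw_imp_inj_on inj_onD)
    moreover have "\<phi> v \<in> spider_verts k l" using that bij by (auto simp: bij_betw_def)
    ultimately show ?thesis by (auto simp: spider_verts_def)
  qed
  have exc_single: "exc v = 0" if "v \<in> V" "t v < 2" for v
    unfolding exc_def using single that by auto
  have sig_sym: "\<sigma> u v = \<sigma> v u" for u v
    unfolding \<sigma>_def by (simp add: add.commute)
  have sig_split: "\<sigma> u v = (j i u - j i v) + (j i v - j i u) +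
       (\<Sum>i'\<in>{..<k} - {i}. (j i' u - j i' v) + (j i' v - j i' u))" if "i < k" for u v i
    unfolding \<sigma>_def using that by (subst sum.remove[of _ i]) auto
  \<comment> \<open>Gains are one-sided: positive \<open>exc u\<close> forces \<open>t u\<close> to
    be at least 2, while \<open>v\<close> is the root or lies on chain \<open>Q u\<close>, which is
    0 or 1. Hence the two gains of a pair never compete.\<close>
  have gain: "spider_dist (\<phi> u) (\<phi> v) + G u (\<phi> v) \<le> \<sigma> u v \<and> G v (\<phi> u) = 0"
    if uv: "u \<in> V" "v \<in> V" "G u (\<phi> v) > 0" for u v
  proof -
    have ex: "exc u > 0" and G: "G u (\<phi> v) = exc u" and disj: "v = c \<or> t v = Q u"
      using uv pos[of v] by (cases "v = c"; auto simp: G_def \<phi>_def split: if_splits)+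
    have jQ: "j (Q u) u = 0" "Q u < 2" using Q[OF uv(1)] ex by (auto simp: exc_def)
    have tu: "\<not> t u < 2" using exc_single[OF uv(1)] ex by auto
    have tv: "t v < 2" using disj c(2) jQ(2) by auto
    have "G v (\<phi> u) = 0" using exc_single[OF uv(2) tv] by (auto simp: G_def)
    moreover have "spider_dist (\<phi> u) (\<phi> v) + exc u \<le> \<sigma> u v"
    proof (cases "v = c")
      case True
      then have "\<sigma> u v = j (t u) u + exc u"
        using sig_split[OF t[OF uv(1)], of u v] c(3) by (simp add: exc_def)
      moreover have "spider_dist (\<phi> u) (\<phi> v) \<le> j (t u) u"
        using True phic c(2,3) by (auto simp: \<phi>_def)
      ultimately show ?thesis by simp
    next
      case False
      then have tvQ: "t v = Q u" using disj by simp
      have ne: "t v \<noteq> t u" using tu tv by auto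
      have jv: "j (t u) v = 0" using single[OF uv(2) tv t[OF uv(1)]] ne by auto
      have "(\<Sum>i\<in>{..<k} - {t u}. (j i u - j i v) + (j i v - j i u))
            = (\<Sum>i\<in>{..<k} - {t u}. j i u + j i v)"
        using single[OF uv(2) tv] jQ tvQ by (intro sum.cong refl) (metis Diff_iff add.right_neutral add_0 diff_0_eq_0 diff_zero lessThan_iff)
      also have "\<dots> = exc u + (\<Sum>i\<in>{..<k} - {t u}. j i v)"
        by (simp add: exc_def sum.distrib)
      finally have "(\<Sum>i\<in>{..<k} - {t u}. (j i u - j i v) + (j i v - j i u))
            = exc u + (\<Sum>i\<in>{..<k} - {t u}. j i v)" .
      moreover have "(\<Sum>i\<in>{..<k} - {t u}. j i v) \<ge> j (t v) v"
        using t[OF uv(2)] ne by (intro member_le_sum) auto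
      ultimately have "\<sigma> u v \<ge> j (t u) u + exc u + j (t v) v"
        using sig_split[OF t[OF uv(1)], of u v] jv by simp
      then show ?thesis using ne by (simp add: \<phi>_def)
    qed
    ultimately show ?thesis using G by simp
  qed
  \<comment> \<open>Only the coordinates \<open>t u\<close> and \<open>t v\<close> of \<sigma> are
    kept. Their truncated differences miss the spider distance by at most \<open>j (t v) u\<close>
    and \<open>j (t u) v\<close>, the \<open>D\<close> terms; at the root all counts vanish.\<close>
  have base: "spider_dist (\<phi> u) (\<phi> v) \<le> \<sigma> u v + D u (\<phi> v) + D v (\<phi> u)"
    if uv: "u \<in> V" "v \<in> V" for u v
  proof (cases "t u = t v")
    case True
    then show ?thesis using sig_split[OF t[OF uv(1)], of u v] by (simp add: \<phi>_def)
  next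
    case False
    have "(j (t v) u - j (t v) v) + (j (t v) v - j (t v) u) \<le>
      (\<Sum>i'\<in>{..<k} - {t u}. (j i' u - j i' v) + (j i' v - j i' u))"
      using t[OF uv(2)] False by (intro member_le_sum) auto
    then have "\<sigma> u v \<ge> (j (t u) u - j (t u) v) + (j (t v) v - j (t v) u)"
      using sig_split[OF t[OF uv(1)], of u v] by simp
    moreover have "D u (\<phi> v) = j (t v) u \<or> v = c" "D v (\<phi> u) = j (t u) v \<or> u = c"
      using False pos[OF uv(2)] pos[OF uv(1)] by (auto simp: D_def \<phi>_def)
    ultimately show ?thesis using False c(3) by (auto simp: \<phi>_def)
  qed
  have pair: "spider_dist (\<phi> u) (\<phi> v) + (G u (\<phi> v) + G v (\<phi> u)) \<le> \<sigma> u v + (D u (\<phi> v) + D v (\<phi> u))"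
    if uv: "u \<in> V" "v \<in> V" for u v
    using gain[OF uv] gain[OF uv(2,1)] base[OF uv] sig_sym[of u v]
      spider_dist_sym[of "\<phi> u" "\<phi> v"] by linarith
  \<comment> \<open>The losses charged to \<open>u\<close> combine chain weights with coefficients
    \<open>j i u\<close>. By \<open>capacity\<close> each such weight is at most \<open>B\<close>,
    and the coefficients add up to \<open>exc u\<close>, the gain at every vertex counted in
    \<open>B\<close>.\<close>
  have compensate: "(\<Sum>v\<in>V. (E u + E v) * D u (\<phi> v)) \<le> (\<Sum>v\<in>V. (E u + E v) * G u (\<phi> v))"
    if u: "u \<in> V" for u
  proof -
    define B where "B = E u + e (0, 0) + (\<Sum>m=1..l (Q u). E u + e (Q u, m))"
    have tr: "(\<Sum>v\<in>V. (E u + E v) * f (\<phi> v)) = (E u + e (0, 0)) * f (0, 0) +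
        (\<Sum>i<k. \<Sum>m=1..l i. (E u + e (i, m)) * f (i, m))" for f
      using sum.reindex_bij_betw[OF bij, of "\<lambda>x. (E u + e x) * f x"]
      by (simp add: E_def sum_spider_verts)
    have "(\<Sum>v\<in>V. (E u + E v) * D u (\<phi> v)) =
        (\<Sum>i<k. \<Sum>m=1..l i. (E u + e (i, m)) * (if i \<noteq> t u then j i u else 0))"
      unfolding tr by (auto simp: D_def intro!: sum.cong)
    also have "\<dots> = (\<Sum>i\<in>{..<k} - {t u}. j i u * (\<Sum>m=1..l i. E u + e (i, m)))"
      using t[OF u] by (subst sum.remove[of _ "t u"])
        (auto simp: sum_distrib_left mult.commute intro!: sum.cong)
    also have "\<dots> \<le> (\<Sum>i\<in>{..<k} - {t u}. j i u * B)"
    proof (intro sum_mono)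
      fix i assume i: "i \<in> {..<k} - {t u}"
      show "j i u * (\<Sum>m=1..l i. E u + e (i, m)) \<le> j i u * B"
        using capacity[OF u, of i] i by (cases "j i u = 0") (auto simp: B_def E_def)
    qed
    also have "\<dots> = exc u * B" by (simp add: exc_def sum_distrib_right)
    also have "\<dots> = (E u + e (0, 0)) * exc u + (\<Sum>m=1..l (Q u). (E u + e (Q u, m)) * G u (Q u, m))"
      by (simp add: B_def G_def distrib_left sum_distrib_left mult.commute)
    also have "\<dots> \<le> (E u + e (0, 0)) * exc u +
        (\<Sum>i<k. \<Sum>m=1..l i. (E u + e (i, m)) * G u (i, m))"
      using Q[OF u] k
      by (intro add_left_mono member_le_sum[of "Q u" _ "\<lambda>i. \<Sum>m=1..l i. (E u + e (i, m)) * G u (i, m)"]) auto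
    also have "\<dots> = (\<Sum>v\<in>V. (E u + E v) * G u (\<phi> v))"
      unfolding tr by (simp add: G_def)
    finally show ?thesis .
  qed
  have sym: "(\<Sum>u\<in>V. \<Sum>v\<in>V. (E u + E v) * f u v) = 2 * (\<Sum>u\<in>V. \<Sum>v\<in>V. E u * f u v)"
    if "\<And>u v. f u v = f v u" for f
  proof -
    have "(\<Sum>u\<in>V. \<Sum>v\<in>V. E v * f u v) = (\<Sum>u\<in>V. \<Sum>v\<in>V. E u * f u v)"
      by (subst sum.swap) (simp add: that)
    then show ?thesis by (simp add: distrib_right sum.distrib)
  qed
  have "(\<Sum>u\<in>V. \<Sum>v\<in>V. (E u + E v) * (spider_dist (\<phi> u) (\<phi> v) + (G u (\<phi> v) + G v (\<phi> u))))
      \<le> (\<Sum>u\<in>V. \<Sum>v\<in>V. (E u + E v) * (\<sigma> u v + (D u (\<phi> v) + D v (\<phi> u))))"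
    using pair by (intro sum_mono mult_left_mono) auto
  then have "(\<Sum>u\<in>V. \<Sum>v\<in>V. (E u + E v) * spider_dist (\<phi> u) (\<phi> v))
        + 2 * (\<Sum>u\<in>V. \<Sum>v\<in>V. (E u + E v) * G u (\<phi> v))
      \<le> (\<Sum>u\<in>V. \<Sum>v\<in>V. (E u + E v) * \<sigma> u v) + 2 * (\<Sum>u\<in>V. \<Sum>v\<in>V. (E u + E v) * D u (\<phi> v))"
    using sum_symmetrize[where e=E and V=V and f="\<lambda>u v. G u (\<phi> v)"] sum_symmetrize[where e=E and V=V and f="\<lambda>u v. D u (\<phi> v)"]
    by (simp only: distrib_left sum.distrib)
  moreover have "(\<Sum>u\<in>V. \<Sum>v\<in>V. (E u + E v) * D u (\<phi> v)) \<le> (\<Sum>u\<in>V. \<Sum>v\<in>V. (E u + E v) * G u (\<phi> v))"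
    by (intro sum_mono compensate)
  ultimately have "(\<Sum>u\<in>V. \<Sum>v\<in>V. E u * spider_dist (\<phi> u) (\<phi> v)) \<le> (\<Sum>u\<in>V. \<Sum>v\<in>V. E u * \<sigma> u v)"
    using sym[of \<sigma>, OF sig_sym] sym[of "\<lambda>u v. spider_dist (\<phi> u) (\<phi> v)", OF spider_dist_sym] by linarith
  moreover have "(\<Sum>u\<in>V. \<Sum>v\<in>V. E u * spider_dist (\<phi> u) (\<phi> v)) =
      (\<Sum>x\<in>spider_verts k l. \<Sum>y\<in>spider_verts k l. e x * spider_dist x y)"
    unfolding sum.reindex_bij_betw[OF bij, symmetric] E_def ..
  ultimately show ?thesis by (simp add: E_def)
qed

section \<open>Balancing the legs of a spider\<close>

text \<open>\<open>R + snd x\<close> stands in for the eccentricity. \<open>R\<close> does not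
  depend on \<open>l\<close>, so it stays fixed while legs exchange vertices.\<close>

definition spider_weight :: "nat \<Rightarrow> nat \<Rightarrow> (nat \<Rightarrow> nat) \<Rightarrow> nat" where
  "spider_weight R k l = (\<Sum>x\<in>spider_verts k l. \<Sum>y\<in>spider_verts k l. (R + snd x) * spider_dist x y)"

lemma spider_verts_cong: "(\<And>i. i < k \<Longrightarrow> l i = l' i) \<Longrightarrow> spider_verts k l = spider_verts k l'"
  by (auto simp: spider_verts_def)

text \<open>A path through the hub is seen from its end at height \<open>y\<close> and indexed by
  the distance \<open>s\<close> from that end. The heights of the end and of the vertex at distance
  \<open>s\<close> add up to \<open>2 * y - s\<close> before the hub and to \<open>s\<close> beyond
  it, hence the maximum. For fixed \<open>y + z\<close> the right side is monotone in
  \<open>y\<close>.\<close>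

lemma path_end_sum:
  fixes y z W :: nat
  assumes "0 < y"
  shows "(W + y) * y + (\<Sum>m=1..y-1. (W + y + m) * (y - m)) + (\<Sum>m=1..z. (W + y + m) * (y + m))
         = (\<Sum>s=1..y+z. (W + max s (2 * y - s)) * s)"
proof -
  have "(\<Sum>m=1..y-1. (W + y + m) * (y - m)) = (\<Sum>s=1..y-1. (W + max s (2 * y - s)) * s)"
  proof (cases "y = 1")
    case False
    have "(\<Sum>m=1..y-1. (W + y + m) * (y - m)) = (\<Sum>s=1..y-1. (W + y + (1 + (y - 1) - s)) * (y - (1 + (y - 1) - s)))"
      by (subst sum.atLeastAtMost_rev) (simp add: add.commute)
    also have "\<dots> = (\<Sum>s=1..y-1. (W + max s (2 * y - s)) * s)"
    proof (intro sum.cong refl)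
      fix s assume "s \<in> {1..y - 1}"
      then have "W + y + (1 + (y - 1) - s) = W + max s (2 * y - s)" "y - (1 + (y - 1) - s) = s"
        by auto
      then show "(W + y + (1 + (y - 1) - s)) * (y - (1 + (y - 1) - s)) = (W + max s (2 * y - s)) * s"
        by metis
    qed
    finally show ?thesis .
  qed simp
  moreover have "(\<Sum>m=1..z. (W + y + m) * (y + m)) = (\<Sum>s=y+1..y+z. (W + max s (2 * y - s)) * s)"
    by (induction z) (auto simp: max_def add.assoc)
  moreover have "(\<Sum>s=1..y+z. (W + max s (2 * y - s)) * s) =
      (\<Sum>s=1..y-1. (W + max s (2 * y - s)) * s) + (W + y) * y +
      (\<Sum>s=y+1..y+z. (W + max s (2 * y - s)) * s)"
  proof -
    have "{1..y+z} = {1..y-1} \<union> {y} \<union> {y+1..y+z}"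
      using assms by auto
    then show ?thesis
      using assms by (simp add: sum.union_disjoint)
  qed
  ultimately show ?thesis by simp
qed

lemma sum_remove2:
  assumes "finite A" "a \<in> A" "b \<in> A" "a \<noteq> b"
  shows "sum f A = f a + (f b + sum f (A - {a} - {b}))"
  using assms sum.remove[of A a f] sum.remove[of "A - {a}" b f] by simp

lemma sum_insert_vertex:
  fixes w :: "nat \<times> nat \<Rightarrow> nat"
  assumes "finite Y" "u \<notin> Y"
  shows "(\<Sum>x\<in>insert u Y. \<Sum>y\<in>insert u Y. w x * spider_dist x y) =
         (\<Sum>x\<in>Y. \<Sum>y\<in>Y. w x * spider_dist x y) + (\<Sum>y\<in>Y. (w u + w y) * spider_dist u y)"
proof -
  have 0: "spider_dist u u = 0" by (cases u) auto
  have "(\<Sum>x\<in>Y. w x * spider_dist x u) = (\<Sum>y\<in>Y. w y * spider_dist u y)"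
    by (intro sum.cong refl) (metis spider_dist_sym)
  then show ?thesis using assms 0
    by (simp add: sum.distrib distrib_right)
qed

text \<open>
  The path formed by legs \<open>a\<close> and \<open>b\<close> keeps its length when its end vertex moves to the other end, so
  after a reflection only the weights on it change, and they decrease; so do the distances from the
  moved vertex to the other legs.
\<close>

lemma spider_weight_move:
  assumes ab: "a < k" "b < k" "a \<noteq> b" and le: "l b < l a"
  shows "spider_weight R k (l(a := l a - 1, b := l b + 1)) \<le> spider_weight R k l"
proof -
  \<comment> \<open>\<open>Y\<close> is the spider without the moved end vertex, which is
    \<open>(a, y)\<close> before and \<open>(b, z)\<close> after the move.\<close>
  define l0 where "l0 = l(a := l a - 1)"
  define Y where "Y = spider_verts k l0"
  define y where "y = l a"
  define z where "z = l b + 1"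
  define w where "w x = R + snd x" for x :: "nat \<times> nat"
  have yz: "0 < y" "0 < z" "z \<le> y" using le by (auto simp: y_def z_def)
  have X: "spider_verts k l = insert (a, y) Y" "(a, y) \<notin> Y"
    using ab yz by (auto simp: spider_verts_def Y_def l0_def y_def split: if_splits)
  have X': "spider_verts k (l(a := l a - 1, b := l b + 1)) = insert (b, z) Y" "(b, z) \<notin> Y"
    using ab yz by (auto simp: spider_verts_def Y_def l0_def y_def z_def split: if_splits)
  have split: "(\<Sum>v\<in>Y. f v) = (f (0, 0) + (\<Sum>m=1..y-1. f (a, m)) + (\<Sum>m=1..z-1. f (b, m))) +
      (\<Sum>i\<in>{..<k} - {a} - {b}. \<Sum>m=1..l i. f (i, m))" for f :: "nat \<times> nat \<Rightarrow> nat"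
  proof -
    have "(\<Sum>v\<in>Y. f v) = f (0, 0) + (\<Sum>i<k. \<Sum>m=1..l0 i. f (i, m))"
      by (simp add: Y_def sum_spider_verts)
    also have "(\<Sum>i<k. \<Sum>m=1..l0 i. f (i, m)) = (\<Sum>m=1..l0 a. f (a, m)) + ((\<Sum>m=1..l0 b. f (b, m)) +
        (\<Sum>i\<in>{..<k} - {a} - {b}. \<Sum>m=1..l0 i. f (i, m)))"
      by (rule sum_remove2) (use ab in auto)
    also have "(\<Sum>i\<in>{..<k} - {a} - {b}. \<Sum>m=1..l0 i. f (i, m)) =
        (\<Sum>i\<in>{..<k} - {a} - {b}. \<Sum>m=1..l i. f (i, m))"
      by (intro sum.cong) (auto simp: l0_def)
    finally show ?thesis using ab by (simp add: l0_def y_def z_def)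
  qed
  have end_sum: "(w (i, p) + w (0, 0)) * spider_dist (i, p) (0, 0)
      + (\<Sum>m=1..p-1. (w (i, p) + w (i, m)) * spider_dist (i, p) (i, m))
      + (\<Sum>m=1..q. (w (i, p) + w (j, m)) * spider_dist (i, p) (j, m))
      = (\<Sum>s=1..p+q. (2 * R + max s (2 * p - s)) * s)" if "0 < p" "i \<noteq> j" for i j p q
  proof -
    have "(\<Sum>m=1..p-1. (w (i, p) + w (i, m)) * spider_dist (i, p) (i, m)) =
        (\<Sum>m=1..p-1. (2 * R + p + m) * (p - m))"
      by (intro sum.cong refl arg_cong2[of _ _ _ _ "(*)"]) (auto simp: w_def)
    moreover have "(\<Sum>m=1..q. (w (i, p) + w (j, m)) * spider_dist (i, p) (j, m)) =
        (\<Sum>m=1..q. (2 * R + p + m) * (p + m))"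
      using that(2) by (intro sum.cong refl) (auto simp: w_def algebra_simps)
    moreover have "(w (i, p) + w (0, 0)) * spider_dist (i, p) (0, 0) = (2 * R + p) * p"
      by (simp add: w_def)
    ultimately show ?thesis
      using path_end_sum[OF that(1), of "2 * R" q] by (simp only:)
  qed
  have "(\<Sum>v\<in>Y. (w (b, z) + w v) * spider_dist (b, z) v) \<le> (\<Sum>v\<in>Y. (w (a, y) + w v) * spider_dist (a, y) v)"
    unfolding split
  proof (rule add_mono)
    \<comment> \<open>The path has \<open>y + z - 1\<close> edges before and after the move, so both
      sums run over the same distances and \<open>z \<le> y\<close> compares them termwise.\<close>
    have "(\<Sum>s=1..z+(y-1). (2 * R + max s (2 * z - s)) * s) \<le> (\<Sum>s=1..z+(y-1). (2 * R + max s (2 * y - s)) * s)"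
      using yz by (intro sum_mono mult_right_mono add_left_mono) auto
    moreover have eq: "z + (y - 1) = y + (z - 1)" using yz by simp
    ultimately show "(w (b, z) + w (0, 0)) * spider_dist (b, z) (0, 0)
        + (\<Sum>m=1..y-1. (w (b, z) + w (a, m)) * spider_dist (b, z) (a, m))
        + (\<Sum>m=1..z-1. (w (b, z) + w (b, m)) * spider_dist (b, z) (b, m))
      \<le> (w (a, y) + w (0, 0)) * spider_dist (a, y) (0, 0)
        + (\<Sum>m=1..y-1. (w (a, y) + w (a, m)) * spider_dist (a, y) (a, m))
        + (\<Sum>m=1..z-1. (w (a, y) + w (b, m)) * spider_dist (a, y) (b, m))"
      using end_sum[OF yz(1) ab(3), of "z - 1"] end_sum[OF yz(2) ab(3)[symmetric], of "y - 1"]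
      unfolding eq by linarith
    show "(\<Sum>i\<in>{..<k} - {a} - {b}. \<Sum>m=1..l i. (w (b, z) + w (i, m)) * spider_dist (b, z) (i, m))
       \<le> (\<Sum>i\<in>{..<k} - {a} - {b}. \<Sum>m=1..l i. (w (a, y) + w (i, m)) * spider_dist (a, y) (i, m))"
      using yz by (intro sum_mono mult_mono) (auto simp: w_def)
  qed
  moreover have "finite Y" by (simp add: Y_def)
  ultimately have "(\<Sum>x\<in>insert (b, z) Y. \<Sum>y\<in>insert (b, z) Y. w x * spider_dist x y)
      \<le> (\<Sum>x\<in>insert (a, y) Y. \<Sum>y\<in>insert (a, y) Y. w x * spider_dist x y)"
    using X(2) X'(2) by (subst (1 2) sum_insert_vertex) auto
  then show ?thesis
    unfolding spider_weight_def X(1) X'(1) w_def .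
qed

text \<open>Some leg \<open>a\<close> exceeds its target and some leg \<open>b\<close> falls short
  of it. Since targets differ by at most 1, \<open>l b < L b \<le> L a + 1 \<le> l a\<close>, so
  moving a vertex from \<open>a\<close> to \<open>b\<close> is allowed and lowers the total surplus
  over \<open>L\<close>.\<close>

lemma spider_weight_balanced_le:
  assumes "\<And>i j. i < k \<Longrightarrow> j < k \<Longrightarrow> L i \<le> L j + 1"
    and "(\<Sum>i<k. l i) = (\<Sum>i<k. L i)"
  shows "spider_weight R k L \<le> spider_weight R k l"
  using assms(2)
proof (induction "\<Sum>i<k. l i - L i" arbitrary: l rule: less_induct)
  case less
  show ?case
  proof (cases "\<forall>i<k. l i = L i")
    case True
    then have "spider_verts k l = spider_verts k L" by (intro spider_verts_cong) auto
    then show ?thesis by (simp add: spider_weight_def)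
  next
    case False
    have ex: "\<exists>a<k. f a < g a" if eq: "(\<Sum>i<k. f i) = (\<Sum>i<k. g i)" and ne: "\<exists>i<k. f i \<noteq> g i" for f g :: "nat \<Rightarrow> nat"
    proof (rule ccontr)
      assume "\<not> ?thesis"
      then have le: "\<forall>i\<in>{..<k}. g i \<le> f i" by (metis lessThan_iff not_less)
      moreover obtain i where "i < k" "f i \<noteq> g i" using ne by blast
      ultimately have "\<exists>i\<in>{..<k}. g i < f i" by (intro bexI[of _ i]) (auto simp: order_less_le)
      with le have "(\<Sum>i<k. g i) < (\<Sum>i<k. f i)"
        by (intro sum_strict_mono_ex1) auto
      then show False using eq by simp
    qed
    obtain a where a: "a < k" "L a < l a" using ex[OF less.prems[symmetric]] False by metis
    obtain b where b: "b < k" "l b < L b" using ex[OF less.prems] False by metis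
    have ab: "a \<noteq> b" "l b < l a" using a(2) b(2) assms(1)[OF b(1) a(1)] by (force, linarith)
    define l' where "l' = l(a := l a - 1, b := l b + 1)"
    have sp: "(\<Sum>i<k. f i) = f a + (f b + (\<Sum>i\<in>{..<k} - {a} - {b}. f i))" for f :: "nat \<Rightarrow> nat"
      by (rule sum_remove2) (use a b ab in auto)
    have l': "l' a = l a - 1" "l' b = l b + 1" "\<And>i. i \<in> {..<k} - {a} - {b} \<Longrightarrow> l' i = l i"
      using ab by (auto simp: l'_def)
    have "(\<Sum>i\<in>{..<k} - {a} - {b}. l' i) = (\<Sum>i\<in>{..<k} - {a} - {b}. l i)"
      by (intro sum.cong refl l'(3))
    then have sum_eq: "(\<Sum>i<k. l' i) = (\<Sum>i<k. l i)"
      using sp[of l] sp[of l'] ab l'(1,2) by linarith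
    have "(\<Sum>i\<in>{..<k} - {a} - {b}. l' i - L i) = (\<Sum>i\<in>{..<k} - {a} - {b}. l i - L i)"
      by (intro sum.cong refl) (metis l'(3))
    moreover have "(l' a - L a) + ((l' b - L b) + s) < (l a - L a) + ((l b - L b) + s)" for s
      using a b l'(1,2) by simp
    ultimately have "(\<Sum>i<k. l' i - L i) < (\<Sum>i<k. l i - L i)"
      unfolding sp[of "\<lambda>i. l' i - L i"] sp[of "\<lambda>i. l i - L i"] by simp
    note less_sum = this
    have "spider_weight R k L \<le> spider_weight R k l'"
      by (rule less.hyps[OF less_sum]) (use sum_eq less.prems in simp)
    also have "\<dots> \<le> spider_weight R k l"
      unfolding l'_def by (rule spider_weight_move[where a=a and b=b and l=l, OF a(1) b(1) ab])
    finally show ?thesis .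
  qed
qed

section \<open>Rooted trees\<close>

lemma sum_card_fibres:
  assumes "finite A" "\<And>x. x \<in> A \<Longrightarrow> g x < (k :: nat)"
  shows "(\<Sum>i<k. card {x \<in> A. g x = i}) = card A"
proof -
  have "g ` A \<subseteq> {..<k}" using assms(2) by auto
  then show ?thesis
    using sum.group[OF assms(1) finite_lessThan[of k], where g=g and h="\<lambda>_. 1::nat"] by simp
qed

text \<open>Compares the chain of length \<open>R\<close> and weight offset \<open>R'\<close> with
  the root and a chain of length \<open>R'\<close> and offset \<open>R\<close>. If
  \<open>R = Suc R'\<close>, an index shift makes the two totals equal, so the smaller offset
  exactly pays for the extra vertex.\<close>

lemma leg_sums:
  fixes R R' E :: nat
  assumes "R = R' \<or> R = Suc R'"
  shows "(\<Sum>m=1..R. E + R' + m) \<le> (\<Sum>m=0..R'. E + R + m)"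
    and "(\<Sum>m=0..R'. E + R + m) \<le> E + R + (\<Sum>m=1..R. E + R' + m)"
proof -
  have "(\<Sum>m=1..Suc R'. E + R' + m) = (\<Sum>m=0..R'. E + Suc R' + m)"
    using sum.shift_bounds_cl_Suc_ivl[of "\<lambda>m. E + R' + m" 0 R'] by (simp del: sum.cl_ivl_Suc)
  moreover have "(\<Sum>m=0..R'. E + R' + m) = E + R' + (\<Sum>m=1..R'. E + R' + m)"
    by (simp add: sum.atLeast_Suc_atMost)
  ultimately show "(\<Sum>m=1..R. E + R' + m) \<le> (\<Sum>m=0..R'. E + R + m)"
    and "(\<Sum>m=0..R'. E + R + m) \<le> E + R + (\<Sum>m=1..R. E + R' + m)"
    using assms by (auto simp del: sum.cl_ivl_Suc)
qed

text \<open>Parent pointers made well founded by depth replace the graph, so that counting takes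
  place on ancestor sets.\<close>

locale rooted_tree =
  fixes V :: "'a set" and c :: 'a and par :: "'a \<Rightarrow> 'a" and dep :: "'a \<Rightarrow> nat"
  assumes finite_V: "finite V"
    and root_in: "c \<in> V"
    and dep_root: "dep c = 0"
    and par_in: "v \<in> V \<Longrightarrow> v \<noteq> c \<Longrightarrow> par v \<in> V"
    and dep_par: "v \<in> V \<Longrightarrow> v \<noteq> c \<Longrightarrow> dep v = Suc (dep (par v))"
begin

text \<open>The path from \<open>v\<close> up to the root, with \<open>v\<close> and without
  \<open>c\<close>. Leaving out \<open>c\<close> makes disjointness say that two non-root vertices
  lie in different branches.\<close>

definition anc :: "'a \<Rightarrow> 'a set" where
  "anc v = (\<lambda>i. (par ^^ i) v) ` {..<dep v}"

text \<open>The tree distance: each non-root vertex stands for the edge to its parent, and the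
  symmetric difference consists of the edges between \<open>u\<close> and \<open>v\<close>.\<close>

definition sep :: "'a \<Rightarrow> 'a \<Rightarrow> nat" where
  "sep u v = card (anc u - anc v) + card (anc v - anc u)"

lemma anc_root [simp]: "anc c = {}"
  by (simp add: anc_def dep_root)

lemma anc_step: "v \<in> V \<Longrightarrow> v \<noteq> c \<Longrightarrow> anc v = insert v (anc (par v))"
  by (simp add: anc_def dep_par lessThan_Suc_eq_insert_0 image_image funpow_Suc_right del: funpow.simps(2))

lemma tree_induct [consumes 1, case_names root step]:
  assumes "v \<in> V" and "P c" and "\<And>v. v \<in> V \<Longrightarrow> v \<noteq> c \<Longrightarrow> P (par v) \<Longrightarrow> P v"
  shows "P v"
  using assms(1)
proof (induction "dep v" arbitrary: v rule: less_induct)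
  case less
  then show ?case
    using assms(2,3) par_in[of v] dep_par[of v] by (cases "v = c") auto
qed

lemma finite_anc [simp]: "finite (anc v)"
  by (simp add: anc_def)

lemma anc_subset: "v \<in> V \<Longrightarrow> anc v \<subseteq> V - {c}"
  by (induction rule: tree_induct) (auto simp: anc_step)

lemma anc_self: "v \<in> V \<Longrightarrow> v \<noteq> c \<Longrightarrow> v \<in> anc v"
  by (simp add: anc_step)

lemma dep_anc: "v \<in> V \<Longrightarrow> x \<in> anc v \<Longrightarrow> x = v \<or> dep x < dep v"
  by (induction rule: tree_induct) (auto simp: anc_step dep_par)

lemma card_anc: "v \<in> V \<Longrightarrow> card (anc v) = dep v"
proof (induction rule: tree_induct)
  case (step v)
  have "v \<notin> anc (par v)"
    using dep_anc[OF par_in[OF step(1,2)], of v] dep_par[OF step(1,2)] by auto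
  then show ?case using step by (simp add: anc_step dep_par)
qed (simp add: dep_root)

lemma anc_trans: "v \<in> V \<Longrightarrow> x \<in> anc v \<Longrightarrow> anc x \<subseteq> anc v"
  by (induction rule: tree_induct) (auto simp: anc_step)

lemma anc_linear: "v \<in> V \<Longrightarrow> x \<in> anc v \<Longrightarrow> y \<in> anc v \<Longrightarrow> x \<in> anc y \<or> y \<in> anc x"
  by (induction rule: tree_induct) (auto simp: anc_step anc_self)

definition tips :: "'a set" where
  "tips = {v \<in> V - {c}. \<forall>u \<in> V - {c}. par u \<noteq> v}"

lemma tips_subset: "tips \<subseteq> V - {c}"
  by (auto simp: tips_def)

lemma tip_below:
  assumes "x \<in> V" "x \<noteq> c"
  obtains w where "w \<in> tips" "x \<in> anc w"
proof -
  let ?S = "{v \<in> V. x \<in> anc v}"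
  have "finite (dep ` ?S)" "dep ` ?S \<noteq> {}" using finite_V assms anc_self by auto
  then obtain w where w: "w \<in> ?S" "dep w = Max (dep ` ?S)"
    using Max_in[of "dep ` ?S"] by (metis (no_types, lifting) imageE)
  have max: "dep v \<le> dep w" if "v \<in> ?S" for v
    unfolding w(2) using finite_V that by (intro Max_ge) auto
  have "par u \<noteq> w" if u: "u \<in> V - {c}" for u
  proof
    assume p: "par u = w"
    have "x \<in> anc u" using w(1) u p anc_step[of u] by blast
    then show False using max[of u] u p dep_par[of u] by simp
  qed
  moreover have "w \<noteq> c" using w(1) by auto
  ultimately have "w \<in> tips" using w(1) by (auto simp: tips_def)
  then show ?thesis using that w(1) by auto
qed

text \<open>
  Chains are formed greedily along the list \<open>w0, w1, ...\<close> of tips, so that the first two are the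
  complete paths from the root to \<open>w0\<close> and \<open>w1\<close>.  If \<open>R = R' + 1\<close> for the depths \<open>R\<close>, \<open>R'\<close> of
  \<open>w0\<close>, \<open>w1\<close>, the centre of the tree is an edge, and below the other end of this edge
  the eccentricity is one less than \<open>R\<close> plus the depth.
\<close>

lemma straighten:
  assumes w: "w0 \<in> V" "w1 \<in> V" "anc w0 \<inter> anc w1 = {}"
    and dep_w: "dep w1 \<le> dep w0" "dep w0 \<le> Suc (dep w1)" "0 < dep w1"
    and dep_max: "\<And>v. v \<in> V \<Longrightarrow> dep v \<le> dep w0"
    and dep_max1: "\<And>v. v \<in> V \<Longrightarrow> anc v \<inter> anc w0 = {} \<Longrightarrow> dep v \<le> dep w1"
    and tips: "card tips \<le> k"
    and ecc: "\<And>v. v \<in> V \<Longrightarrow> (if anc v \<inter> anc w0 = {} then dep w0 else dep w1) + dep v \<le> ecc v"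
  defines "e \<equiv> \<lambda>x. (if fst x = 0 \<and> snd x > 0 then dep w1 else dep w0) + snd x"
  shows "\<exists>l. (\<Sum>i<k. l i) = card V - 1 \<and> l 0 = dep w0 \<and> (\<forall>i. 0 < i \<longrightarrow> i < k \<longrightarrow> l i \<le> dep w1) \<and>
     (\<Sum>x\<in>spider_verts k l. \<Sum>y\<in>spider_verts k l. e x * spider_dist x y)
       \<le> (\<Sum>u\<in>V. \<Sum>v\<in>V. ecc u * sep u v)"
proof -
  have wc: "w0 \<noteq> c" "w1 \<noteq> c" using dep_w dep_root by auto
  have tip0: "w0 \<in> tips"
    using w(1) wc dep_max dep_par by (force simp: tips_def)
  \<comment> \<open>\<open>dep_max1\<close> bounds only vertices whose root path avoids
    \<open>anc w0\<close>; a child of \<open>w1\<close> violating this would put \<open>w1\<close>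
    itself on that path.\<close>
  have tip1: "w1 \<in> tips"
  proof -
    have "par z \<noteq> w1" if z: "z \<in> V" "z \<noteq> c" for z
    proof
      assume p: "par z = w1"
      have "anc z \<inter> anc w0 \<noteq> {}" using dep_max1[OF z(1)] dep_par[OF z] p by auto
      then have "z \<in> anc w0" using w(3) p anc_step[OF z] by auto
      then have "w1 \<in> anc w0" using anc_trans[OF w(1)] anc_step[OF z] anc_self[OF w(2) wc(2)] p by auto
      then show False using w(3) anc_self[OF w(2) wc(2)] by auto
    qed
    then show ?thesis using w(2) wc by (auto simp: tips_def)
  qed
  have w01: "w0 \<noteq> w1" using w(3) anc_self[OF w(1) wc(1)] by auto
  have fin_tips: "finite tips" using finite_V tips_subset finite_subset by fastforce
  obtain xs where xs: "set xs = tips - {w0, w1}" "distinct xs"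
    using finite_distinct_list[of "tips - {w0, w1}"] fin_tips by auto
  define ls where "ls = w0 # w1 # xs"
  have ls: "set ls = tips" "distinct ls" "ls ! 0 = w0" "ls ! 1 = w1" "2 \<le> length ls"
    using xs tip0 tip1 w01 by (auto simp: ls_def)
  have lenk: "length ls \<le> k" using tips ls distinct_card by metis
  have k2: "2 \<le> k" using lenk ls(5) by simp
  have lsV: "ls ! i \<in> V" if "i < length ls" for i using ls(1) that tips_subset nth_mem by blast
  \<comment> \<open>Chain \<open>i\<close> is the root path of tip \<open>i\<close> minus the paths
    of earlier tips. The value 0 at \<open>c\<close> sends the root to the hub
    \<open>(0, 0)\<close>.\<close>
  define t where "t x = (if x = c then 0 else LEAST i. i < length ls \<and> x \<in> anc (ls ! i))" for x
  have ex: "\<exists>i. i < length ls \<and> x \<in> anc (ls ! i)" if "x \<in> V" "x \<noteq> c" for x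
    using tip_below[OF that] ls(1) by (metis in_set_conv_nth)
  have tx: "t x < length ls \<and> x \<in> anc (ls ! t x)" if "x \<in> V" "x \<noteq> c" for x
    using LeastI_ex[OF ex[OF that]] that by (simp add: t_def)
  have tle: "t x \<le> i" if "x \<noteq> c" "i < length ls" "x \<in> anc (ls ! i)" for x i
    using that by (auto simp: t_def intro: Least_le)
  have t0: "t x = 0 \<longleftrightarrow> x \<in> anc w0" if "x \<in> V" "x \<noteq> c" for x
  proof
    show "t x = 0 \<Longrightarrow> x \<in> anc w0" using tx[OF that] ls(3) by auto
    show "x \<in> anc w0 \<Longrightarrow> t x = 0" using tle[OF that(2), of 0] ls(3,5) by (cases ls) auto
  qed
  have t1: "t x = 1" if "x \<in> anc w1" for x
  proof -
    have x: "x \<in> V" "x \<noteq> c" using that anc_subset[OF w(2)] by auto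
    have "t x \<le> 1" using tle[OF x(2), of 1] ls(4,5) that by simp
    moreover have "t x \<noteq> 0" using t0[OF x] w(3) that by auto
    ultimately show ?thesis by simp
  qed
  define j where "j i v = card {x \<in> anc v. t x = i}" for i v
  define l where "l i = card {x \<in> V - {c}. t x = i}" for i
  define \<phi> where "\<phi> v = (t v, j (t v) v)" for v
  have tk: "t v < k" if "v \<in> V" for v
    using tx[OF that] lenk k2 by (cases "v = c") (auto simp: t_def)
  have tc: "t c = 0" by (simp add: t_def)
  have jc: "j i c = 0" for i by (simp add: j_def)
  have jpos: "0 < j (t v) v" if "v \<in> V" "v \<noteq> c" for v
    using anc_self[OF that] by (auto simp: j_def card_gt_0_iff)
  have jl: "j i v \<le> l i" if "v \<in> V" for i v
    unfolding j_def l_def using anc_subset[OF that] finite_V by (intro card_mono) auto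
  have l_sum: "(\<Sum>i<k. l i) = card V - 1"
    unfolding l_def using sum_card_fibres[of "V - {c}" t k] finite_V tk root_in by simp
  have inj: "inj_on \<phi> V"
  proof -
    \<comment> \<open>Vertices of one chain are comparable, and the lower one has strictly more
      vertices of the chain on its root path.\<close>
    have "u = v" if uv: "u \<in> V" "v \<in> V" "t u = t v" "j (t u) u = j (t v) v" "u \<in> anc v" for u v
    proof (rule ccontr)
      assume ne: "u \<noteq> v"
      have c: "u \<noteq> c" "v \<noteq> c" using uv(5) anc_subset[OF uv(2)] by auto
      have "v \<notin> anc u" using dep_anc[OF uv(1), of v] dep_anc[OF uv(2,5)] ne by auto
      then have "{x \<in> anc u. t x = t u} \<subset> {x \<in> anc v. t x = t v}"
        using anc_trans[OF uv(2,5)] anc_self[OF uv(2) c(2)] uv(3) by auto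
      then have "j (t u) u < j (t v) v" unfolding j_def by (intro psubset_card_mono) auto
      then show False using uv(4) by simp
    qed note below = this
    show ?thesis
    proof (rule inj_onI)
      fix u v assume uv: "u \<in> V" "v \<in> V" "\<phi> u = \<phi> v"
      then have eq: "t u = t v" "j (t u) u = j (t v) v" by (auto simp: \<phi>_def)
      show "u = v"
      proof (cases "u = c \<or> v = c")
        case True
        then show ?thesis using eq jpos[OF uv(1)] jpos[OF uv(2)] jc by (metis less_irrefl)
      next
        case False
        then have "u \<in> anc (ls ! t u)" "v \<in> anc (ls ! t u)" "ls ! t u \<in> V"
          using tx[OF uv(1)] tx[OF uv(2)] eq(1) lsV by simp_all
        then have "u \<in> anc v \<or> v \<in> anc u" using anc_linear by blast
        then show ?thesis using below uv(1,2) eq by metis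
      qed
    qed
  qed
  have bij: "bij_betw \<phi> V (spider_verts k l)"
  proof -
    have "\<phi> v \<in> spider_verts k l" if v: "v \<in> V" for v
      using jpos[OF v] jl[OF v, of "t v"] tk[OF v] tc jc by (cases "v = c") (auto simp: \<phi>_def spider_verts_def)
    then have sub: "\<phi> ` V \<subseteq> spider_verts k l" by auto
    have "card (spider_verts k l) = 1 + (\<Sum>i<k. l i)"
      using sum_spider_verts[of "\<lambda>_. 1::nat" k l] by simp
    moreover have "0 < card V" using root_in finite_V card_gt_0_iff by blast
    then have "1 + (\<Sum>i<k. l i) = card V" unfolding l_sum by simp
    ultimately have "card (\<phi> ` V) = card (spider_verts k l)" using card_image[OF inj] by simp
    then have "\<phi> ` V = spider_verts k l" by (intro card_subset_eq sub) auto
    then show ?thesis using inj by (simp add: bij_betw_def)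
  qed
  have j0: "j 0 v = card (anc v \<inter> anc w0)" if v: "v \<in> V" for v
    unfolding j_def using anc_subset[OF v] t0 by (intro arg_cong[of _ _ card]) auto
  \<comment> \<open>A long chain avoided by the root path of \<open>v\<close>: by linearity of
    ancestors, a path meeting \<open>anc w0\<close> cannot meet \<open>anc w1\<close>.\<close>
  define Q where "Q v = (if anc v \<inter> anc w0 = {} then 0 else 1 :: nat)" for v
  have jQ: "j (Q v) v = 0" if v: "v \<in> V" for v
  proof (cases "anc v \<inter> anc w0 = {}")
    case True
    then show ?thesis using j0[OF v] by (simp add: Q_def)
  next
    case False
    then obtain y where y: "y \<in> anc v" "y \<in> anc w0" by auto
    have "t x \<noteq> 1" if x: "x \<in> anc v" for x
    proof
      assume "t x = 1"
      then have "x \<in> anc w1" using tx[of x] anc_subset[OF v] x ls(4) by auto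
      then show False using anc_linear[OF v x y(1)] anc_trans[OF w(1) y(2)] anc_trans[OF w(2), of x] w(3) y(2) by auto
    qed
    then have "{x \<in> anc v. t x = 1} = {}" by auto
    then show ?thesis using False by (simp add: Q_def j_def)
  qed
  have single: "j i v = 0" if v: "v \<in> V" "t v < 2" "i < k" "i \<noteq> t v" for v i
  proof (cases "v = c")
    case False
    have "t x = t v" if x: "x \<in> anc v" for x
    proof (cases "t v = 0")
      case True
      then have "x \<in> anc w0" using t0[OF v(1) False] anc_trans[OF w(1)] x by blast
      then show ?thesis using t0[of x] True anc_subset[OF w(1)] by auto
    next
      case 1: False
      then have tv: "t v = 1" using v(2) by simp
      then have "x \<in> anc w1" using tx[OF v(1) False] ls(4) anc_trans[OF w(2)] x by auto
      then show ?thesis using t1 tv by simp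
    qed
    then have "{x \<in> anc v. t x = i} = {}" using v(4) by auto
    then show ?thesis unfolding j_def by (simp only: card.empty)
  qed (simp add: jc)
  have l0: "l 0 = dep w0"
  proof -
    have "{x \<in> V - {c}. t x = 0} = anc w0" using t0 anc_subset[OF w(1)] by auto
    then show ?thesis using card_anc[OF w(1)] by (simp add: l_def)
  qed
  have l1: "l 1 = dep w1"
  proof -
    have "{x \<in> V - {c}. t x = 1} = anc w1" using t1 anc_subset[OF w(2)] tx ls(4) by (auto; metis One_nat_def)
    then show ?thesis using card_anc[OF w(2)] by (simp add: l_def)
  qed
  have off0: "card (anc v - anc w0) < dep v" if "v \<in> V" "anc v \<inter> anc w0 \<noteq> {}" for v
  proof -
    have "anc v - anc w0 \<subset> anc v" using that(2) by auto
    then show ?thesis using psubset_card_mono[OF finite_anc] card_anc[OF that(1)] by metis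
  qed
  have l_le: "l i \<le> dep w1" if i: "0 < i" for i
  proof (cases "i < length ls")
    case True
    define v where "v = ls ! i"
    have v: "v \<in> V" using lsV True by (simp add: v_def)
    have "{x \<in> V - {c}. t x = i} \<subseteq> anc v - anc w0"
    proof
      fix x assume x: "x \<in> {x \<in> V - {c}. t x = i}"
      then show "x \<in> anc v - anc w0" using tx[of x] t0[of x] i by (simp add: v_def)
    qed
    then have "l i \<le> card (anc v - anc w0)" unfolding l_def by (intro card_mono) auto
    \<comment> \<open>A root path that meets \<open>anc w0\<close> may have depth
      \<open>dep w0\<close>, but it gives up at least one vertex to chain 0, which covers the
      possible difference of 1.\<close>
    moreover have "card (anc v - anc w0) \<le> dep w1"
    proof (cases "anc v \<inter> anc w0 = {}")
      case True
      then have "anc v - anc w0 = anc v" by auto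
      then show ?thesis using dep_max1[OF v True] card_anc[OF v] by simp
    next
      case False
      then show ?thesis using off0[OF v False] dep_max[OF v] dep_w(2) by simp
    qed
    ultimately show ?thesis by simp
  next
    case False
    then have "{x \<in> V - {c}. t x = i} = {}" using tx by auto
    then show ?thesis unfolding l_def by (simp only: card.empty)
  qed
  define R where "R = dep w0"
  define R1 where "R1 = dep w1"
  have capacity: "(\<Sum>m=1..l i. e (\<phi> u) + e (i, m)) \<le>
        e (\<phi> u) + e (0, 0) + (\<Sum>m=1..l (Q u). e (\<phi> u) + e (Q u, m))"
    if u: "u \<in> V" "i < k" "0 < j i u" for u i
  proof -
    define E where "E = e (\<phi> u)"
    \<comment> \<open>\<open>B\<close> is the weight of the root with chain 1. It separates the two
      sides: no single chain weighs more, and the root with either long chain weighs no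
      less.\<close>
    define B where "B = (\<Sum>m=0..R1. E + R + m)"
    have "R = R1 \<or> R = Suc R1" using dep_w by (auto simp: R_def R1_def)
    note f0 = leg_sums[OF this, of E, folded B_def]
    have B: "B = E + R + (\<Sum>m=1..R1. E + R + m)"
      unfolding B_def by (simp only: sum.atLeast_Suc_atMost[OF le0]) simp
    have e0: "(\<Sum>m=1..d. E + e (0, m)) = (\<Sum>m=1..d. E + R1 + m)" for d
      by (intro sum.cong refl) (auto simp: e_def R1_def)
    have e1: "(\<Sum>m=1..d. E + e (i, m)) = (\<Sum>m=1..d. E + R + m)" if "i \<noteq> 0" for d i
      using that by (intro sum.cong refl) (auto simp: e_def R_def)
    have e00: "e (0, 0) = R" by (simp add: e_def R_def)
    have "(\<Sum>m=1..l i. E + e (i, m)) \<le> B"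
    proof (cases "i = 0")
      case True
      show ?thesis unfolding True e0 l0 R_def[symmetric] by (rule f0(1))
    next
      case False
      then have "(\<Sum>m=1..l i. E + e (i, m)) = (\<Sum>m=1..l i. E + R + m)" by (rule e1)
      also have "\<dots> \<le> (\<Sum>m=1..R1. E + R + m)"
        using l_le[of i] False by (intro sum_mono2) (auto simp: R1_def)
      finally show ?thesis unfolding B by linarith
    qed
    moreover have "B \<le> E + e (0, 0) + (\<Sum>m=1..l (Q u). E + e (Q u, m))"
    proof (cases "Q u = 0")
      case True
      show ?thesis unfolding True e0 l0 e00 R_def[symmetric] by (rule f0(2))
    next
      case False
      then have Q1: "Q u = 1" by (auto simp: Q_def split: if_splits)
      show ?thesis unfolding Q1 e1[OF one_neq_zero] l1 e00 R1_def[symmetric] B by (rule order_refl)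
    qed
    ultimately show ?thesis unfolding E_def by (rule order_trans)
  qed
  have "(\<Sum>x\<in>spider_verts k l. \<Sum>y\<in>spider_verts k l. e x * spider_dist x y)
      \<le> (\<Sum>u\<in>V. \<Sum>v\<in>V. e (t u, j (t u) u) * (\<Sum>i<k. (j i u - j i v) + (j i v - j i u)))"
  proof (rule straighten_sum[where c = c and Q = Q])
    show "bij_betw (\<lambda>v. (t v, j (t v) v)) V (spider_verts k l)" using bij by (simp add: \<phi>_def[abs_def])
    show "Q v < 2 \<and> j (Q v) v * (\<Sum>i\<in>{..<k} - {t v}. j i v) = 0" if "v \<in> V" for v
      using jQ[OF that] by (auto simp: Q_def)
    show "(\<Sum>m=1..l i. e (t u, j (t u) u) + e (i, m)) \<le>
        e (t u, j (t u) u) + e (0, 0) + (\<Sum>m=1..l (Q u). e (t u, j (t u) u) + e (Q u, m))"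
      if "u \<in> V" "i < k" "i \<noteq> t u" "0 < j i u" for u i
      using capacity[OF that(1,2,4)] by (simp add: \<phi>_def)
  qed (fact root_in tc jc tk single k2)+
  also have "\<dots> \<le> (\<Sum>u\<in>V. \<Sum>v\<in>V. ecc u * sep u v)"
  proof (intro sum_mono mult_mono)
    fix u v assume uv: "u \<in> V" "v \<in> V"
    show "e (t u, j (t u) u) \<le> ecc u"
    proof (cases "t u = 0")
      case True
      show ?thesis
      proof (cases "u = c")
        case True
        then show ?thesis using ecc[OF uv(1)] tc jc dep_root by (simp add: e_def)
      next
        case False
        then have "u \<in> anc u \<inter> anc w0" using t0[OF uv(1)] True anc_self[OF uv(1)] by auto
        moreover have "j 0 u \<le> dep u"
          using card_anc[OF uv(1)] card_mono[OF finite_anc, of "{x \<in> anc u. t x = 0}" u] by (auto simp: j_def)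
        moreover have "e (t u, j (t u) u) = dep w1 + j 0 u"
          using True jpos[OF uv(1) False] by (simp add: e_def)
        moreover have "dep w1 + dep u \<le> ecc u"
          using ecc[OF uv(1)] calculation(1) by (metis empty_iff)
        ultimately show ?thesis by linarith
      qed
    next
      case False
      have "{x \<in> anc u. t x = t u} \<subseteq> anc u - anc w0"
      proof
        fix x assume x: "x \<in> {x \<in> anc u. t x = t u}"
        then have "t x \<noteq> 0" "x \<in> V" "x \<noteq> c" using False anc_subset[OF uv(1)] by auto
        then show "x \<in> anc u - anc w0" using t0[of x] x by simp
      qed
      note sub = this
      have e_off: "e (t u, j (t u) u) = dep w0 + j (t u) u" using False by (simp add: e_def)
      have le: "j (t u) u \<le> card (anc u - anc w0)" unfolding j_def by (intro card_mono sub) auto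
      show ?thesis
      proof (cases "anc u \<inter> anc w0 = {}")
        case True
        then have "anc u - anc w0 = anc u" by auto
        then have "j (t u) u \<le> dep u" using le card_anc[OF uv(1)] by simp
        moreover have "dep w0 + dep u \<le> ecc u" using ecc[OF uv(1)] True by simp
        ultimately show ?thesis unfolding e_off by linarith
      next
        case F: False
        \<comment> \<open>Here \<open>u\<close> hangs below the long path but off chain 0. Its new
          weight has offset \<open>dep w0\<close>, perhaps one too many, and its depth has dropped
          by at least one.\<close>
        have "dep w1 + dep u \<le> ecc u" using ecc[OF uv(1)] F by simp
        then show ?thesis unfolding e_off using le off0[OF uv(1) F] dep_w(2) by linarith
      qed
    qed
    have half: "(\<Sum>i<k. j i x - j i y) \<le> card (anc x - anc y)" if "x \<in> V" for x y
    proof -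
      have "(\<Sum>i<k. j i x - j i y) \<le> (\<Sum>i<k. card {z \<in> anc x - anc y. t z = i})"
      proof (intro sum_mono)
        fix i
        have "j i x - j i y \<le> card ({z \<in> anc x. t z = i} - {z \<in> anc y. t z = i})"
          unfolding j_def by (rule diff_card_le_card_Diff) simp
        also have "{z \<in> anc x. t z = i} - {z \<in> anc y. t z = i} = {z \<in> anc x - anc y. t z = i}" by auto
        finally show "j i x - j i y \<le> card {z \<in> anc x - anc y. t z = i}" .
      qed
      also have "\<dots> = card (anc x - anc y)"
        using tk anc_subset[OF that] by (intro sum_card_fibres) auto
      finally show ?thesis .
    qed
    show "(\<Sum>i<k. (j i u - j i v) + (j i v - j i u)) \<le> sep u v"
      using half[OF uv(1), of v] half[OF uv(2), of u] by (simp add: sum.distrib sep_def)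
  qed simp_all
  finally have "(\<Sum>x\<in>spider_verts k l. \<Sum>y\<in>spider_verts k l. e x * spider_dist x y)
      \<le> (\<Sum>u\<in>V. \<Sum>v\<in>V. ecc u * sep u v)" .
  then show ?thesis by (intro exI[of _ l] conjI l_sum l0 allI impI l_le)
qed

section \<open>Tree distance through ancestor sets\<close>

lemma sep_sym: "sep u v = sep v u"
  by (simp add: sep_def)

lemma sep_triangle: "sep u w \<le> sep u v + sep v w"
proof -
  have "card (anc x - anc z) \<le> card (anc x - anc y) + card (anc y - anc z)" for x y z
  proof -
    have "card (anc x - anc z) \<le> card ((anc x - anc y) \<union> (anc y - anc z))"
      by (intro card_mono) auto
    also have "\<dots> \<le> card (anc x - anc y) + card (anc y - anc z)" by (rule card_Un_le)
    finally show ?thesis .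
  qed
  from this[of u w v] this[of w u v] show ?thesis by (simp add: sep_def)
qed

lemma sep_par:
  assumes "v \<in> V" "v \<noteq> c"
  shows "sep v (par v) = 1"
proof -
  have "v \<notin> anc (par v)"
    using dep_anc[OF par_in[OF assms], of v] dep_par[OF assms] by auto
  then have "anc v - anc (par v) = {v}" "anc (par v) - anc v = {}"
    using anc_step[OF assms] by auto
  then show ?thesis unfolding sep_def by (simp only: card.empty) simp
qed

lemma sep_disjoint:
  assumes "u \<in> V" "v \<in> V" "anc u \<inter> anc v = {}"
  shows "sep u v = dep u + dep v"
proof -
  have "anc u - anc v = anc u" "anc v - anc u = anc v" using assms(3) by auto
  then show ?thesis using card_anc assms(1,2) by (simp add: sep_def)
qed

text \<open>\<open>x\<close> is the child of the root in whose branch \<open>v\<close> lies; it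
  serves as a name for that branch.\<close>

lemma top_anc:
  assumes "v \<in> V" "v \<noteq> c"
  obtains x where "x \<in> anc v" "dep x = 1" "\<And>y. y \<in> anc v \<Longrightarrow> x \<in> anc y"
proof -
  have "v \<noteq> c \<longrightarrow> (\<exists>x \<in> anc v. dep x = 1 \<and> (\<forall>y \<in> anc v. x \<in> anc y))"
    using assms(1)
  proof (induction rule: tree_induct)
    case (step v)
    show ?case
    proof (cases "par v = c")
      case True
      then show ?thesis using step(1,2) anc_step[OF step(1,2)] dep_par[OF step(1,2)] dep_root by simp
    next
      case False
      then obtain x where x: "x \<in> anc (par v)" "dep x = 1" "\<forall>y \<in> anc (par v). x \<in> anc y"
        using step(3) by blast
      then show ?thesis using anc_step[OF step(1,2)] by (intro impI bexI[of _ x]) auto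
    qed
  qed simp
  then show ?thesis using assms(2) that by blast
qed

end

section \<open>Shortest walks and breadth-first parents\<close>

context pair_graph
begin

lemma graph_dist_le: "awalk u p v \<Longrightarrow> graph_dist G u v \<le> length p"
  unfolding graph_dist_def by (rule Least_le) auto

end

locale connected_pair_graph = pair_graph +
  assumes conn: "Digraph_Component.connected (with_proj G)"
begin

lemma shortest_walk:
  assumes "u \<in> pverts G" "v \<in> pverts G"
  obtains p where "awalk u p v" "length p = graph_dist G u v"
proof -
  have "strongly_connected (with_proj G)"
    using conn symmetric_connected_imp_strongly_connected pair_sym_arcs by blast
  then have "\<exists>p. awalk u p v"
    using assms by (auto simp: strongly_connected_def reachable_awalk)
  then have "\<exists>l p. awalk u p v \<and> length p = l" by blast
  then have "\<exists>p. awalk u p v \<and> length p = graph_dist G u v"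
    unfolding graph_dist_def by (rule LeastI_ex)
  then show ?thesis using that by blast
qed

lemma graph_dist_self: "u \<in> pverts G \<Longrightarrow> graph_dist G u u = 0"
  using graph_dist_le[of u "[]" u] by (simp add: awalk_Nil_iff)

lemma graph_dist_arc_right:
  assumes "u \<in> pverts G" "(v, w) \<in> parcs G"
  shows "graph_dist G u w \<le> Suc (graph_dist G u v)"
proof -
  obtain p where p: "awalk u p v" "length p = graph_dist G u v"
    using shortest_walk assms in_arcsD1 by metis
  have "awalk v [(v, w)] w" using assms(2) by (simp add: awalk_simps in_arcsD2)
  then have "awalk u (p @ [(v, w)]) w" using p(1) by (rule awalk_appendI[rotated])
  from graph_dist_le[OF this] show ?thesis using p(2) by simp
qed

lemma graph_dist_arc_left:
  assumes "w \<in> pverts G" "(u, v) \<in> parcs G"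
  shows "graph_dist G u w \<le> Suc (graph_dist G v w)"
proof -
  obtain p where p: "awalk v p w" "length p = graph_dist G v w"
    using shortest_walk assms in_arcsD2 by metis
  then have "awalk u ((u, v) # p) w" using assms(2) by (simp add: awalk_Cons_iff)
  from graph_dist_le[OF this] show ?thesis using p(2) by simp
qed

lemma closer_neighbour:
  assumes "c \<in> pverts G" "v \<in> pverts G" "v \<noteq> c"
  obtains u where "(u, v) \<in> parcs G" "graph_dist G c v = Suc (graph_dist G c u)"
proof -
  obtain p where p: "awalk c p v" "length p = graph_dist G c v"
    using shortest_walk assms by metis
  have "p \<noteq> []" using p(1) assms(3) by (auto simp: awalk_Nil_iff)
  then obtain q e where q: "p = q @ [e]" by (metis rev_exhaust)
  have e: "e \<in> parcs G" "snd e = v" "awalk c q (fst e)"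
    using p(1) unfolding q awalk_append_iff by (auto simp: awalk_simps)
  have "graph_dist G c (fst e) \<le> length q" using e(3) by (rule graph_dist_le)
  moreover have "graph_dist G c v \<le> Suc (graph_dist G c (fst e))"
    using e(1,2) assms(1) by (intro graph_dist_arc_right) (auto simp: prod_eq_iff)
  ultimately have "graph_dist G c v = Suc (graph_dist G c (fst e))" using p(2) q by simp
  then show ?thesis using that[of "fst e"] e(1,2) by (metis prod.collapse)
qed

definition bfs_parent :: "'a \<Rightarrow> 'a \<Rightarrow> 'a" where
  "bfs_parent c v = (SOME u. (u, v) \<in> parcs G \<and> graph_dist G c v = Suc (graph_dist G c u))"

lemma bfs_parent:
  assumes "c \<in> pverts G" "v \<in> pverts G" "v \<noteq> c"
  shows "(bfs_parent c v, v) \<in> parcs G" "graph_dist G c v = Suc (graph_dist G c (bfs_parent c v))"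
proof -
  have "\<exists>u. (u, v) \<in> parcs G \<and> graph_dist G c v = Suc (graph_dist G c u)"
    using closer_neighbour[OF assms] by metis
  from someI_ex[OF this] show "(bfs_parent c v, v) \<in> parcs G" "graph_dist G c v = Suc (graph_dist G c (bfs_parent c v))"
    unfolding bfs_parent_def by auto
qed

lemma rooted_tree_bfs:
  assumes "c \<in> pverts G"
  shows "rooted_tree (pverts G) c (bfs_parent c) (graph_dist G c)"
  using assms bfs_parent[OF assms] in_arcsD1 graph_dist_self pair_finite_verts
  by unfold_locales blast+

end

section \<open>Trees rooted at a centre, and the lower bound\<close>

locale simple_tree_graph = connected_pair_graph +
  assumes acyclic: "\<not> (\<exists>p. cycle p \<and> 3 \<le> length p)"
begin

text \<open>The one place where acyclicity enters. An arc outside the set \<open>H\<close> of parent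
  arcs and their reverses would be closed by the \<open>H\<close>-walk from \<open>w\<close> through
  \<open>c\<close> to \<open>u\<close>. Shortened to a path, that walk still has at least two arcs,
  as \<open>(w, u)\<close> is not in \<open>H\<close>, so a cycle of length at least 3
  arises.\<close>

lemma arc_is_parent:
  assumes c: "c \<in> pverts G" and arc: "(u, w) \<in> parcs G"
  shows "(w \<noteq> c \<and> u = bfs_parent c w) \<or> (u \<noteq> c \<and> w = bfs_parent c u)"
proof (rule ccontr)
  assume not: "\<not> ?thesis"
  interpret rooted_tree "pverts G" c "bfs_parent c" "graph_dist G c"
    by (rule rooted_tree_bfs[OF c])
  define H where "H = {(x, bfs_parent c x) | x. x \<noteq> c} \<union> {(bfs_parent c x, x) | x. x \<noteq> c}"
  have nH: "(u, w) \<notin> H" "(w, u) \<notin> H" using not by (auto simp: H_def)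
  have "\<exists>p q. awalk v p c \<and> awalk c q v \<and> set p \<subseteq> H \<and> set q \<subseteq> H" if "v \<in> pverts G" for v
    using that
  proof (induction rule: tree_induct)
    case root
    have "awalk c [] c" using c by (simp add: awalk_Nil_iff)
    then show ?case by (intro exI[of _ "[]"]) simp
  next
    case (step v)
    then obtain p q where pq: "awalk (bfs_parent c v) p c" "awalk c q (bfs_parent c v)" "set p \<subseteq> H" "set q \<subseteq> H"
      by blast
    have a: "(bfs_parent c v, v) \<in> parcs G" using bfs_parent(1) c step(1,2) by blast
    then have "awalk v ((v, bfs_parent c v) # p) c"
      using pq(1) arcs_symmetric by (simp add: awalk_Cons_iff)
    moreover have "awalk c (q @ [(bfs_parent c v, v)]) v"
      using pq(2) a by (intro awalk_appendI[of c q "bfs_parent c v"]) (auto simp: awalk_simps in_arcsD2)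
    ultimately show ?case
      using pq(3,4) step(2)
      by (intro exI[of _ "(v, bfs_parent c v) # p"] exI[of _ "q @ [(bfs_parent c v, v)]"]) (auto simp: H_def)
  qed
  note to_root = this
  obtain p q where pq: "awalk w p c" "awalk c q u" "set p \<subseteq> H" "set q \<subseteq> H"
    using to_root[of u] to_root[of w] arc in_arcsD1 in_arcsD2 by metis
  have walk: "awalk w (p @ q) u" using pq(1,2) by (rule awalk_appendI)
  define s where "s = awalk_to_apath (p @ q)"
  have s: "apath w s u" "set s \<subseteq> H"
    using apath_awalk_to_apath[OF walk] awalk_to_apath_subset[OF walk] pq(3,4) by (auto simp: s_def)
  have "s \<noteq> []" using s(1) no_loops'[OF arc] by (auto simp: apath_Nil_iff)
  moreover have "s \<noteq> [e]" for e
    using s nH by (auto simp: apath_simps)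
  ultimately have "2 \<le> length s"
    by (cases s; cases "tl s") auto
  moreover have "cycle ((u, w) # s)"
    unfolding cycle_def using s(1) arc by (intro exI[of _ u]) (auto simp: apath_def awalk_Cons_iff)
  ultimately show False using acyclic by (metis Suc_le_mono eval_nat_numeral(3) length_Cons)
qed

text \<open>Each arc joins a vertex to its parent and so has \<open>sep\<close> equal to 1; the
  triangle inequality then bounds \<open>sep\<close> by the length of any walk.\<close>

lemma graph_dist_ge_sep:
  assumes c: "c \<in> pverts G" and "u \<in> pverts G" "v \<in> pverts G"
  shows "rooted_tree.sep (bfs_parent c) (graph_dist G c) u v \<le> graph_dist G u v"
proof -
  interpret rooted_tree "pverts G" c "bfs_parent c" "graph_dist G c"
    by (rule rooted_tree_bfs[OF c])
  have arc: "sep x y = 1" if "(x, y) \<in> parcs G" for x y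
    using arc_is_parent[OF c that] sep_par sep_sym in_arcsD1[OF that] in_arcsD2[OF that] by metis
  have "awalk u p v \<Longrightarrow> sep u v \<le> length p" for u p v
  proof (induction p arbitrary: u)
    case Nil
    then show ?case by (simp add: awalk_Nil_iff sep_def)
  next
    case (Cons e p)
    then have "(u, snd e) \<in> parcs G" "awalk (snd e) p v" by (auto simp: awalk_Cons_iff)
    then show ?case
      using Cons.IH[of "snd e"] arc[of u "snd e"] sep_triangle[of u v "snd e"] by simp
  qed
  moreover obtain p where "awalk u p v" "length p = graph_dist G u v"
    using shortest_walk assms by metis
  ultimately show ?thesis by metis
qed

lemma tips_leaves:
  assumes c: "c \<in> pverts G"
  shows "rooted_tree.tips (pverts G) c (bfs_parent c) \<subseteq> leaves G"
proof
  interpret rooted_tree "pverts G" c "bfs_parent c" "graph_dist G c"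
    by (rule rooted_tree_bfs[OF c])
  fix v assume v: "v \<in> tips"
  then have vV: "v \<in> pverts G" "v \<noteq> c" by (auto simp: tips_def)
  have "out_arcs (with_proj G) v = {(v, bfs_parent c v)}"
  proof (intro equalityI subsetI)
    fix e assume "e \<in> out_arcs (with_proj G) v"
    then have e: "e \<in> parcs G" "fst e = v" by (auto simp: out_arcs_def)
    then have "(v, snd e) \<in> parcs G" by auto
    then have "snd e = bfs_parent c v"
      using arc_is_parent[OF c, of v "snd e"] v in_arcsD2[of v "snd e"] by (auto simp: tips_def)
    then show "e \<in> {(v, bfs_parent c v)}" using e(2) by (simp add: prod_eq_iff)
  next
    fix e assume "e \<in> {(v, bfs_parent c v)}"
    moreover have "(v, bfs_parent c v) \<in> parcs G"
      using bfs_parent(1)[OF c vV] arcs_symmetric by blast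
    ultimately show "e \<in> out_arcs (with_proj G) v" by (simp add: out_arcs_def)
  qed
  then show "v \<in> leaves G" using vV by (simp add: leaves_def out_degree_def)
qed

lemma eccentricity_ge: "u \<in> pverts G \<Longrightarrow> graph_dist G v u \<le> eccentricity G v"
  unfolding eccentricity_def using pair_finite_verts by (intro Max_ge) auto

text \<open>\<open>straighten\<close> is applied at a vertex of least eccentricity. The bounds on
  single legs are kept in the conclusion because the exceptional case of the final comparison
  identifies \<open>l\<close> by counting.\<close>

lemma spider_lower_bound:
  assumes leaves: "card (leaves G) = k" and k: "k < card (pverts G) - 1"
  shows "\<exists>l R R'. (\<Sum>i<k. l i) = card (pverts G) - 1 \<and> l 0 = R \<and> (\<forall>i. 0 < i \<longrightarrow> i < k \<longrightarrow> l i \<le> R') \<and>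
     R' \<le> R \<and> R \<le> Suc R' \<and>
     (\<Sum>x\<in>spider_verts k l. \<Sum>y\<in>spider_verts k l.
        ((if fst x = 0 \<and> snd x > 0 then R' else R) + snd x) * spider_dist x y) \<le> eccentric_distance_sum G"
proof -
  have ne: "pverts G \<noteq> {}" using k by auto
  define c where "c = arg_min_on (eccentricity G) (pverts G)"
  have c: "c \<in> pverts G" and c_min: "\<And>v. v \<in> pverts G \<Longrightarrow> eccentricity G c \<le> eccentricity G v"
    using arg_min_if_finite[OF pair_finite_verts ne, of "eccentricity G"] by (force simp: c_def not_less)+
  interpret rooted_tree "pverts G" c "bfs_parent c" "graph_dist G c"
    by (rule rooted_tree_bfs[OF c])
  define R where "R = eccentricity G c"
  have "R \<in> graph_dist G c ` pverts G"
    unfolding R_def eccentricity_def using pair_finite_verts ne by (intro Max_in) auto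
  then obtain w0 where w0: "w0 \<in> pverts G" "graph_dist G c w0 = R" by auto
  have dep_max: "graph_dist G c v \<le> R" if "v \<in> pverts G" for v
    unfolding R_def using that by (rule eccentricity_ge)
  have fin_leaves: "finite (leaves G)" using pair_finite_verts by (simp add: leaves_def)
  have tips_k: "card tips \<le> k" using card_mono[OF fin_leaves tips_leaves[OF c]] leaves by simp
  \<comment> \<open>Radius at most 1 would make every non-root vertex a tip, giving a star with more
    than \<open>k\<close> leaves.\<close>
  have R2: "2 \<le> R"
  proof (rule ccontr)
    assume "\<not> 2 \<le> R"
    then have "bfs_parent c u = c" if "u \<in> pverts G" "u \<noteq> c" for u
      using dep_max[OF that(1)] dep_par[OF that] par_in[OF that] dep_par[of "bfs_parent c u"] by fastforce
    then have "tips = pverts G - {c}" by (auto simp: tips_def)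
    then show False using tips_k k c pair_finite_verts by simp
  qed
  have w0c: "w0 \<noteq> c" using w0 R2 dep_root by auto
  obtain x0 where x0: "x0 \<in> anc w0" "graph_dist G c x0 = 1" "\<And>y. y \<in> anc w0 \<Longrightarrow> x0 \<in> anc y"
    using top_anc[OF w0(1) w0c] by blast
  have x0V: "x0 \<in> pverts G" "x0 \<noteq> c" using anc_subset[OF w0(1)] x0(1) by auto
  have down: "x \<in> anc u \<longrightarrow> graph_dist G x u + graph_dist G c x \<le> graph_dist G c u" if "u \<in> pverts G" "x \<in> pverts G" for u x
    using that(1)
  proof (induction rule: tree_induct)
    case (step v)
    have "graph_dist G x v \<le> Suc (graph_dist G x (bfs_parent c v))"
      using bfs_parent(1)[OF c step(1,2)] that(2) by (rule graph_dist_arc_right[rotated])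
    then show ?case using step(3) dep_par[OF step(1,2)] graph_dist_self[OF step(1)] anc_step[OF step(1,2)] by auto
  qed simp
  \<comment> \<open>If every vertex outside the branch of \<open>x0\<close> had depth at most \<open>R - 2\<close>, then \<open>x0\<close> would have
    smaller eccentricity than \<open>c\<close>.\<close>
  define U where "U = {w \<in> pverts G. anc w \<inter> anc w0 = {}}"
  have finU: "finite U" "c \<in> U" using pair_finite_verts c by (auto simp: U_def)
  have "Max (graph_dist G c ` U) \<in> graph_dist G c ` U" using finU by (intro Max_in) auto
  then obtain w1 where w1: "w1 \<in> U" "graph_dist G c w1 = Max (graph_dist G c ` U)" by auto
  have dep_max1: "graph_dist G c v \<le> graph_dist G c w1" if "v \<in> U" for v
    unfolding w1(2) using finU that by (intro Max_ge) auto
  have w1R: "R \<le> Suc (graph_dist G c w1)"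
  proof (rule ccontr)
    assume less: "\<not> ?thesis"
    have "graph_dist G x0 u \<le> R - 1" if u: "u \<in> pverts G" for u
    proof (cases "u \<in> U")
      case True
      have "bfs_parent c x0 = c"
        using dep_par[OF x0V] x0(2) par_in[OF x0V] dep_par[of "bfs_parent c x0"] by fastforce
      then have "(x0, c) \<in> parcs G" using bfs_parent(1)[OF c x0V] arcs_symmetric by simp
      then have "graph_dist G x0 u \<le> Suc (graph_dist G c u)" using u by (rule graph_dist_arc_left[rotated])
      then show ?thesis using dep_max1[OF True] less by simp
    next
      case False
      then obtain y where "y \<in> anc u" "y \<in> anc w0" using u by (auto simp: U_def)
      then have "x0 \<in> anc u" using x0(3) anc_trans[OF u] by blast
      then show ?thesis using down[OF u x0V(1)] x0(2) dep_max[OF u] by simp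
    qed
    then have "eccentricity G x0 \<le> R - 1"
      unfolding eccentricity_def using pair_finite_verts ne by (subst Max_le_iff) auto
    then show False using c_min[OF x0V(1)] R2 by (simp add: R_def)
  qed
  have w1V: "w1 \<in> pverts G" "anc w1 \<inter> anc w0 = {}" using w1(1) by (auto simp: U_def)
  define R' where "R' = graph_dist G c w1"
  have ecc: "(if anc v \<inter> anc w0 = {} then R else R') + graph_dist G c v \<le> eccentricity G v" if v: "v \<in> pverts G" for v
  proof (cases "anc v \<inter> anc w0 = {}")
    case True
    have "R + graph_dist G c v = sep v w0" using sep_disjoint[OF v w0(1) True] w0(2) by simp
    also have "\<dots> \<le> graph_dist G v w0" by (rule graph_dist_ge_sep[OF c v w0(1)])
    also have "\<dots> \<le> eccentricity G v" using w0(1) by (rule eccentricity_ge)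
    finally show ?thesis using True by simp
  next
    case False
    have "anc v \<inter> anc w1 = {}"
    proof (rule ccontr)
      assume "anc v \<inter> anc w1 \<noteq> {}"
      then obtain y z where yz: "y \<in> anc v" "y \<in> anc w0" "z \<in> anc v" "z \<in> anc w1" using False by auto
      show False
        using anc_linear[OF v yz(1,3)]
      proof
        assume "y \<in> anc z"
        then show False using anc_trans[OF w1V(1) yz(4)] w1V(2) yz(2) by auto
      next
        assume "z \<in> anc y"
        then show False using anc_trans[OF w0(1) yz(2)] w1V(2) yz(4) by auto
      qed
    qed
    then have "R' + graph_dist G c v = sep v w1" using sep_disjoint[OF v w1V(1)] by (simp add: R'_def)
    also have "\<dots> \<le> graph_dist G v w1" by (rule graph_dist_ge_sep[OF c v w1V(1)])
    also have "\<dots> \<le> eccentricity G v" using w1V(1) by (rule eccentricity_ge)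
    finally show ?thesis using False by simp
  qed
  have R'R: "R' \<le> R" "R \<le> Suc R'" "0 < R'" using dep_max[OF w1V(1)] w1R R2 by (auto simp: R'_def)
  have "\<exists>l. (\<Sum>i<k. l i) = card (pverts G) - 1 \<and> l 0 = R \<and> (\<forall>i. 0 < i \<longrightarrow> i < k \<longrightarrow> l i \<le> R') \<and>
     (\<Sum>x\<in>spider_verts k l. \<Sum>y\<in>spider_verts k l.
        ((if fst x = 0 \<and> snd x > 0 then R' else R) + snd x) * spider_dist x y)
       \<le> (\<Sum>u\<in>pverts G. \<Sum>v\<in>pverts G. eccentricity G u * sep u v)"
    unfolding R'_def w0(2)[symmetric]
  proof (rule straighten)
    show "anc w0 \<inter> anc w1 = {}" using w1V(2) by auto
    show "graph_dist G c v \<le> graph_dist G c w1" if "v \<in> pverts G" "anc v \<inter> anc w0 = {}" for v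
      using dep_max1[of v] that by (simp add: U_def)
    show "(if anc v \<inter> anc w0 = {} then graph_dist G c w0 else graph_dist G c w1) + graph_dist G c v
        \<le> eccentricity G v" if "v \<in> pverts G" for v
      using ecc[OF that] by (simp only: w0(2) R'_def)
  qed (use w0 w1V R'R tips_k dep_max in \<open>simp_all add: R'_def\<close>)
  moreover have "(\<Sum>u\<in>pverts G. \<Sum>v\<in>pverts G. eccentricity G u * sep u v) \<le> eccentric_distance_sum G"
    unfolding eccentric_distance_sum_def dist_sum_def sum_distrib_left
  proof (intro sum_mono mult_left_mono)
    fix u v assume uv: "u \<in> pverts G" "v \<in> pverts G"
    then show "sep u v \<le> graph_dist G v u" using graph_dist_ge_sep[OF c uv(2,1)] sep_sym by metis
  qed simp
  ultimately show ?thesis using R'R(1,2) by (meson order_trans)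
qed

end

section \<open>The spider as a graph\<close>

text \<open>On a cycle of length at least 3, a vertex of largest \<open>dep\<close> has two distinct
  neighbours, neither of larger \<open>dep\<close>.\<close>

lemma (in pair_graph) no_long_cycle:
  fixes dep :: "'a \<Rightarrow> nat"
  assumes unique: "\<And>v x y. (x, v) \<in> parcs G \<Longrightarrow> (y, v) \<in> parcs G \<Longrightarrow> dep x \<le> dep v \<Longrightarrow> dep y \<le> dep v \<Longrightarrow> x = y"
  shows "\<not> (\<exists>p. cycle p \<and> 3 \<le> length p)"
proof
  assume "\<exists>p. cycle p \<and> 3 \<le> length p"
  then obtain p u where p: "awalk u p u" "distinct (tl (awalk_verts u p))" "3 \<le> length p"
    by (auto simp: cycle_def)
  then obtain e q where pq: "p = e # q" by (cases p) auto
  define w where "w = snd e"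
  have e: "e = (u, w)" "(u, w) \<in> parcs G" and q: "apath w q u" "2 \<le> length q"
    using p by (auto simp: pq awalk_Cons_iff apath_def w_def)
  have arcs_q: "set q \<subseteq> parcs G" using q(1) by (auto simp: apath_def)
  obtain f q' where qf: "q = f # q'" "q' \<noteq> []" using q(2) by (cases q; cases "tl q") auto
  define z where "z = snd f"
  have f: "f = (w, z)" "(w, z) \<in> parcs G" and q': "apath z q' u" "w \<notin> set (awalk_verts z q')"
    using q(1) by (auto simp: qf apath_Cons_iff z_def)
  have zu: "z \<noteq> u" using apath_nonempty_ends[OF q'(1) qf(2)] .
  define W where "W = set (awalk_verts w q)"
  have finW: "finite W" "W \<noteq> {}" by (auto simp: W_def)
  have "Max (dep ` W) \<in> dep ` W" using finW by (intro Max_in) auto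
  then obtain m where m: "m \<in> W" "dep m = Max (dep ` W)" by auto
  have max: "dep v \<le> dep m" if "v \<in> W" for v
    unfolding m(2) using finW that by (intro Max_ge) auto
  have walk: "awalk w q u" using q(1) by (rule awalkI_apath)
  have inW: "x \<in> W" "y \<in> W" if "(x, y) \<in> set q" for x y
    using that awalk_verts_arc1[OF that, of w] awalk_verts_arc2[OF walk that] by (auto simp: W_def)
  have uW: "u \<in> W" "w \<in> W"
    using hd_in_awalk_verts(1)[OF walk] last_in_set[OF awalk_verts_non_Nil[of w q]] walk
    by (auto simp: W_def)
  have two: False if "(x, m) \<in> parcs G" "(m, y) \<in> parcs G" "x \<in> W" "y \<in> W" "x \<noteq> y" for x y
    using unique[OF that(1), of y] that arcs_symmetric max by blast
  show False
  \<comment> \<open>The cycle is the arc \<open>(u, w)\<close> followed by the path \<open>q\<close>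
    from \<open>w\<close> to \<open>u\<close>. The ends of \<open>q\<close> have
    \<open>(u, w)\<close> as one of their cycle arcs and are treated separately.\<close>
  proof (cases "m = w")
    case True
    then show False using two[of u z] e(2) f(2) uW inW[of w z] zu by (auto simp: qf f(1))
  next
    case mw: False
    obtain x where x: "(x, m) \<in> set q"
    proof -
      have "pcas w q u" using walk by auto
      then have "W = insert w (snd ` set q)"
        unfolding W_def by (subst awalk_verts_conv') (auto simp: qf f(1))
      then show ?thesis using m(1) mw that by auto
    qed
    show False
    proof (cases "m = u")
      case True
      have "(x, m) \<in> set q'" using x True zu by (auto simp: qf f(1))
      then have "x \<noteq> w" using q'(2) awalk_verts_arc1[of "(x, m)" q' z] by auto
      then show False using two[of x w] x arcs_q e(2) True inW[OF x] uW by auto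
    next
      case False
      obtain p1 y p2 where "q = p1 @ (x, m) # (m, y) # p2" "x \<noteq> y"
        using apath_succ_decomp[OF q(1) x False] by blast
      then show False using two[of x y] x arcs_q inW[OF x] inW[of m y] by auto
    qed
  qed
qed

section \<open>Spiders: distances, acyclicity, leaves and an upper bound\<close>

locale spider_graph =
  fixes as :: "nat list"
  assumes legs: "2 \<le> length as" and pos: "\<And>i. i < length as \<Longrightarrow> 0 < as ! i"
begin

abbreviation "X \<equiv> spider_verts (length as) ((!) as)"

lemma pverts_spider: "pverts (spider as) = X"
proof -
  have "{leg_vertex i j |i j. i < length as \<and> j \<le> as ! i} \<subseteq> X"
    by (auto simp: spider_verts_def leg_vertex_def)
  moreover have "X \<subseteq> insert (0, 0) {leg_vertex i j |i j. i < length as \<and> j \<le> as ! i}"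
  proof
    fix x assume "x \<in> X"
    then consider "x = (0, 0)" | i j where "x = (i, j)" "i < length as" "1 \<le> j" "j \<le> as ! i"
      by (auto simp: spider_verts_def)
    then show "x \<in> insert (0, 0) {leg_vertex i j |i j. i < length as \<and> j \<le> as ! i}"
    proof cases
      case 2
      then have "x = leg_vertex i j" by (simp add: leg_vertex_def)
      then show ?thesis using 2 by blast
    qed simp
  qed
  ultimately show ?thesis by (auto simp: spider_def spider_verts_def)
qed

lemma arc_cases:
  "(x, y) \<in> parcs (spider as) \<longleftrightarrow> (\<exists>i j. i < length as \<and> j < as ! i \<and>
     (x = leg_vertex i j \<and> y = (i, Suc j) \<or> x = (i, Suc j) \<and> y = leg_vertex i j))"
proof -
  have "leg_vertex i (Suc j) = (i, Suc j)" for i j by (simp add: leg_vertex_def)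
  then show ?thesis unfolding spider_def by simp blast
qed

lemma leg_arcs:
  assumes "i < length as" "j < as ! i"
  shows "(leg_vertex i j, leg_vertex i (Suc j)) \<in> parcs (spider as)"
    and "(leg_vertex i (Suc j), leg_vertex i j) \<in> parcs (spider as)"
proof -
  have "leg_vertex i (Suc j) = (i, Suc j)" by (simp add: leg_vertex_def)
  then show "(leg_vertex i j, leg_vertex i (Suc j)) \<in> parcs (spider as)"
    and "(leg_vertex i (Suc j), leg_vertex i j) \<in> parcs (spider as)"
    unfolding arc_cases using assms by blast+
qed

lemma vertexE:
  assumes "x \<in> X"
  obtains i j where "i < length as" "j \<le> as ! i" "x = leg_vertex i j" "x = (i, j)"
proof (cases "x = (0, 0)")
  case True
  moreover have "0 < length as" using legs by linarith
  ultimately show ?thesis using that[of 0 0] by (simp add: leg_vertex_def)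
next
  case False
  then obtain i j where "x = (i, j)" "i < length as" "1 \<le> j" "j \<le> as ! i"
    using assms by (auto simp: spider_verts_def)
  then show ?thesis using that[of i j] by (simp add: leg_vertex_def)
qed

lemma leg_vertex_in: "i < length as \<Longrightarrow> j \<le> as ! i \<Longrightarrow> leg_vertex i j \<in> X"
  by (auto simp: spider_verts_def leg_vertex_def)

sublocale pair_graph "spider as"
proof
  have arc_in: "x \<in> X \<and> y \<in> X \<and> x \<noteq> y \<and> (y, x) \<in> parcs (spider as)" if arc: "(x, y) \<in> parcs (spider as)" for x y
  proof -
    obtain i j where ij: "i < length as" "j < as ! i"
      "x = leg_vertex i j \<and> y = (i, Suc j) \<or> x = (i, Suc j) \<and> y = leg_vertex i j"
      using iffD1[OF arc_cases arc] by blast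
    moreover have "(i, Suc j) \<in> X" "leg_vertex i j \<in> X" "leg_vertex i j \<noteq> (i, Suc j)"
      using leg_vertex_in[of i j] leg_vertex_in[of i "Suc j"] ij(1,2) by (auto simp: leg_vertex_def)
    moreover have "(y, x) \<in> parcs (spider as)"
      unfolding arc_cases using ij by blast
    ultimately show ?thesis by auto
  qed
  show "fst e \<in> pverts (spider as)" "snd e \<in> pverts (spider as)" if "e \<in> parcs (spider as)" for e
    using arc_in[of "fst e" "snd e"] that by (auto simp: pverts_spider)
  show "finite (pverts (spider as))" by (simp add: pverts_spider)
  have "parcs (spider as) \<subseteq> X \<times> X" using arc_in by auto
  then show "finite (parcs (spider as))" by (rule finite_subset) auto
  show "fst e \<noteq> snd e" if "e \<in> parcs (spider as)" for e
    using arc_in[of "fst e" "snd e"] that by auto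
  show "symmetric (with_proj (spider as))"
    using arc_in by (auto simp: symmetric_def intro!: symI)
qed

lemma leg_walk:
  assumes "i < length as" "a \<le> b" "b \<le> as ! i"
  shows "\<exists>p. awalk (leg_vertex i a) p (leg_vertex i b) \<and> length p = b - a"
    and "\<exists>p. awalk (leg_vertex i b) p (leg_vertex i a) \<and> length p = b - a"
proof -
  have "(\<exists>p. awalk (leg_vertex i a) p (leg_vertex i b) \<and> length p = b - a) \<and>
        (\<exists>p. awalk (leg_vertex i b) p (leg_vertex i a) \<and> length p = b - a)"
    using assms(2,3)
  proof (induction b rule: dec_induct)
    case base
    have "awalk (leg_vertex i a) [] (leg_vertex i a)"
      using leg_vertex_in[OF assms(1) base] by (simp add: awalk_Nil_iff pverts_spider)
    then show ?case by (metis diff_self_eq_0 list.size(3))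
  next
    case (step b)
    then obtain p p' where p: "awalk (leg_vertex i a) p (leg_vertex i b)" "length p = b - a"
      and p': "awalk (leg_vertex i b) p' (leg_vertex i a)" "length p' = b - a" by auto
    have arcs: "(leg_vertex i b, leg_vertex i (Suc b)) \<in> parcs (spider as)"
        "(leg_vertex i (Suc b), leg_vertex i b) \<in> parcs (spider as)"
      using assms(1) step.prems leg_arcs by auto
    have "awalk (leg_vertex i b) [(leg_vertex i b, leg_vertex i (Suc b))] (leg_vertex i (Suc b))"
      using arcs(1) by (simp add: awalk_simps in_arcsD2)
    then have "awalk (leg_vertex i a) (p @ [(leg_vertex i b, leg_vertex i (Suc b))]) (leg_vertex i (Suc b))"
      by (rule awalk_appendI[OF p(1)])
    moreover have "awalk (leg_vertex i (Suc b)) ((leg_vertex i (Suc b), leg_vertex i b) # p') (leg_vertex i a)"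
      using arcs(2) p'(1) by (simp add: awalk_Cons_iff)
    moreover have "length (p @ [(leg_vertex i b, leg_vertex i (Suc b))]) = Suc b - a"
      "length ((leg_vertex i (Suc b), leg_vertex i b) # p') = Suc b - a"
      using p(2) p'(2) step.hyps(1) by auto
    ultimately show ?case by blast
  qed
  then show "\<exists>p. awalk (leg_vertex i a) p (leg_vertex i b) \<and> length p = b - a"
    and "\<exists>p. awalk (leg_vertex i b) p (leg_vertex i a) \<and> length p = b - a" by auto
qed

text \<open>An explicit walk bounds \<open>graph_dist\<close> from above, the direction required of
  the smaller side of the final comparison.\<close>

lemma walk_spider_dist:
  assumes "x \<in> X" "y \<in> X"
  obtains p where "awalk x p y" "length p = spider_dist x y"
proof -
  obtain i a where x: "i < length as" "a \<le> as ! i" "x = leg_vertex i a" "x = (i, a)"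
    using vertexE[OF assms(1)] .
  obtain j b where y: "j < length as" "b \<le> as ! j" "y = leg_vertex j b" "y = (j, b)"
    using vertexE[OF assms(2)] .
  show ?thesis
  proof (cases "i = j")
    case True
    have "spider_dist x y = (if a \<le> b then b - a else a - b)" using True x(4) y(4) by simp
    then show ?thesis
      using leg_walk[OF x(1), of a b] leg_walk[OF x(1), of b a] x y True that
      by (metis nat_le_linear)
  next
    case False
    obtain p where p: "awalk x p (leg_vertex i 0)" "length p = a"
      using leg_walk(2)[OF x(1) _ x(2), of 0] x(3) by auto
    obtain q where q: "awalk (leg_vertex j 0) q y" "length q = b"
      using leg_walk(1)[OF y(1) _ y(2), of 0] y(3) by auto
    have "leg_vertex i 0 = leg_vertex j 0" by (simp add: leg_vertex_def)
    then have "awalk x (p @ q) y" using p(1) q(1) awalk_appendI by metis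
    moreover have "length (p @ q) = spider_dist x y" using False p(2) q(2) x(4) y(4) by simp
    ultimately show ?thesis by (rule that)
  qed
qed

lemma simple_tree_spider: "simple_tree (spider as)"
  unfolding simple_tree_def
proof (intro conjI)
  show "pair_graph (spider as)" ..
  show "Digraph_Component.connected (with_proj (spider as))"
  proof (rule wf_digraph.connectedI)
    show "wf_digraph (with_proj (spider as))" ..
    show "verts (with_proj (spider as)) \<noteq> {}" by (simp add: pverts_spider spider_verts_def)
    fix u v assume "u \<in> verts (with_proj (spider as))" "v \<in> verts (with_proj (spider as))"
    then have "u \<in> X" "v \<in> X" by (simp_all add: pverts_spider)
    then obtain p where "awalk u p v" using walk_spider_dist by metis
    then show "u \<rightarrow>\<^sup>*\<^bsub>with_proj (mk_symmetric (with_proj (spider as)))\<^esub> v"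
      by (intro reachable_mk_symmetricI reachable_awalkI)
  qed
  show "\<not> (\<exists>p. cycle p \<and> 3 \<le> length p)"
  proof (rule no_long_cycle[where dep = snd])
    fix v x y assume a: "(x, v) \<in> parcs (spider as)" "(y, v) \<in> parcs (spider as)" "snd x \<le> snd v" "snd y \<le> snd v"
    have "x = leg_vertex (fst v) (snd v - 1)" if "(x, v) \<in> parcs (spider as)" "snd x \<le> snd v" for x
      using that unfolding arc_cases by (auto simp: leg_vertex_def split: if_splits)
    then show "x = y" using a by metis
  qed
qed

lemma card_spider: "card (pverts (spider as)) = 1 + (\<Sum>i<length as. as ! i)"
  using sum_spider_verts[of "\<lambda>_. 1::nat" "length as" "(!) as"] by (simp add: pverts_spider)

lemma leaves_spider: "leaves (spider as) = (\<lambda>i. (i, as ! i)) ` {..<length as}"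
proof -
  have deg: "out_degree (with_proj (spider as)) v = card {y. (v, y) \<in> parcs (spider as)}" for v
  proof -
    have "out_arcs (with_proj (spider as)) v = Pair v ` {y. (v, y) \<in> parcs (spider as)}"
      by (auto simp: out_arcs_def)
    then show ?thesis by (simp add: out_degree_def card_image inj_on_def)
  qed
  have hub: "out_degree (with_proj (spider as)) (0, 0) \<noteq> 1"
  proof -
    have fin: "finite {y. ((0, 0), y) \<in> parcs (spider as)}"
      by (rule finite_subset[OF _ pair_finite_verts]) (auto intro: in_arcsD2)
    have l0: "0 < length as" using legs by linarith
    have "{(0, 1), (1, 1)} \<subseteq> {y. ((0, 0), y) \<in> parcs (spider as)}"
      using legs l0 pos[of 0] pos[of 1] leg_arcs(1)[of 0 0] leg_arcs(1)[of 1 0]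
      by (simp add: leg_vertex_def del: length_greater_0_conv)
    from card_mono[OF fin this] show ?thesis unfolding deg by simp
  qed
  have nbrs: "{y. ((i, j), y) \<in> parcs (spider as)} =
      insert (leg_vertex i (j - 1)) (if j < as ! i then {(i, Suc j)} else {})"
    if "i < length as" "1 \<le> j" "j \<le> as ! i" for i j
  proof -
    have lv: "leg_vertex i j = (i, j)" "leg_vertex i (Suc j) = (i, Suc j)" "leg_vertex i (Suc (j - 1)) = (i, j)"
      using that by (auto simp: leg_vertex_def)
    have "((i, j), leg_vertex i (j - 1)) \<in> parcs (spider as)"
      using leg_arcs(2)[of i "j - 1"] that unfolding lv by simp
    moreover have "((i, j), (i, Suc j)) \<in> parcs (spider as)" if "j < as ! i"
      using leg_arcs(1)[of i j] that \<open>i < length as\<close> unfolding lv by simp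
    moreover have "y = leg_vertex i (j - 1) \<or> j < as ! i \<and> y = (i, Suc j)"
      if "((i, j), y) \<in> parcs (spider as)" for y
    proof -
      obtain a b where "b < as ! a" "(i, j) = leg_vertex a b \<and> y = (a, Suc b) \<or> (i, j) = (a, Suc b) \<and> y = leg_vertex a b"
        using iffD1[OF arc_cases \<open>((i, j), y) \<in> parcs (spider as)\<close>] by blast
      then show ?thesis using \<open>1 \<le> j\<close> by (auto simp: leg_vertex_def split: if_splits)
    qed
    ultimately show ?thesis by (intro set_eqI) (auto split: if_splits)
  qed
  have inner: "out_degree (with_proj (spider as)) (i, j) = 1 \<longleftrightarrow> j = as ! i"
    if "i < length as" "1 \<le> j" "j \<le> as ! i" for i j
    unfolding deg nbrs[OF that] using that by (auto simp: leg_vertex_def)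
  show ?thesis
  proof (intro equalityI subsetI)
    fix v assume "v \<in> leaves (spider as)"
    then have v: "v \<in> X" "out_degree (with_proj (spider as)) v = 1" by (auto simp: leaves_def pverts_spider)
    then obtain i j where ij: "v = (i, j)" "i < length as" "1 \<le> j" "j \<le> as ! i"
      using hub by (auto simp: spider_verts_def)
    then show "v \<in> (\<lambda>i. (i, as ! i)) ` {..<length as}" using inner[OF ij(2-4)] v(2) by auto
  next
    fix v assume "v \<in> (\<lambda>i. (i, as ! i)) ` {..<length as}"
    then obtain i where i: "v = (i, as ! i)" "i < length as" by auto
    then show "v \<in> leaves (spider as)"
      using inner[OF i(2), of "as ! i"] pos[OF i(2)] by (auto simp: leaves_def pverts_spider spider_verts_def)
  qed
qed

lemma card_leaves_spider: "card (leaves (spider as)) = length as"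
  unfolding leaves_spider by (subst card_image) (auto simp: inj_on_def)

text \<open>The bound \<open>e\<close> is left free because the two cases of the final comparison
  use different weights.\<close>

lemma eccentric_distance_sum_spider_le:
  assumes "\<And>x y. x \<in> X \<Longrightarrow> y \<in> X \<Longrightarrow> spider_dist x y \<le> e x"
  shows "eccentric_distance_sum (spider as) \<le> (\<Sum>x\<in>X. \<Sum>y\<in>X. e x * spider_dist x y)"
proof -
  have dist: "graph_dist (spider as) x y \<le> spider_dist x y" if "x \<in> X" "y \<in> X" for x y
    using walk_spider_dist[OF that] graph_dist_le by metis
  have ne: "X \<noteq> {}" by (simp add: spider_verts_def)
  have ecc: "eccentricity (spider as) x \<le> e x" if x: "x \<in> X" for x
  proof -
    have "\<forall>d \<in> graph_dist (spider as) x ` X. d \<le> e x"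
      using order_trans[OF dist[OF x] assms[OF x]] by blast
    then show ?thesis
      unfolding eccentricity_def pverts_spider using ne by (subst Max_le_iff) auto
  qed
  show ?thesis
    unfolding eccentric_distance_sum_def dist_sum_def sum_distrib_left pverts_spider
  proof (intro sum_mono mult_mono)
    fix x y assume "x \<in> X" "y \<in> X"
    then show "eccentricity (spider as) x \<le> e x" "graph_dist (spider as) y x \<le> spider_dist x y"
      using ecc dist[of y x] spider_dist_sym[of x y] by simp_all
  qed simp_all
qed

end

section \<open>The extremal tree\<close>

theorem theorem3p3:
  fixes n k r :: nat
  assumes "3 \<le> k" and "k \<le> n - 2"
    and "r \<in> {0..k - 1}" and "[n - 1 = r] (mod k)"
  defines "S \<equiv> spider (replicate r (nat \<lceil>real (n - 1) / real k\<rceil>)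
                     @ replicate (k - r) (nat \<lfloor>real (n - 1) / real k\<rfloor>))"
  shows "S \<in> trees_with_leaves n k \<and>
         (\<forall>T \<in> (trees_with_leaves n k :: 'a pair_pre_digraph set).
            eccentric_distance_sum S \<le> eccentric_distance_sum T)"
proof -
  define q where "q = (n - 1) div k"
  have k: "3 \<le> k" "k < n - 1" using assms(1,2) by auto
  have rk: "r < k" using assms(1,3) by auto
  have r: "r = (n - 1) mod k" using assms(4) rk by (simp add: cong_def)
  have nqr: "n - 1 = k * q + r" unfolding q_def r by simp
  have q1: "1 \<le> q" unfolding q_def using k by (simp add: Suc_le_eq div_greater_zero_iff)
  define q' where "q' = (if r = 0 then q else q + 1)"
  \<comment> \<open>For \<open>r = 0\<close> the ceiling is \<open>q\<close> and not
    \<open>q + 1\<close>, but then the first block is empty.\<close>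
  define as where "as = replicate r (q + 1) @ replicate (k - r) q"
  have fl: "nat \<lfloor>real (n - 1) / real k\<rfloor> = q"
    by (simp add: q_def floor_divide_of_nat_eq)
  have ce: "nat \<lceil>real (n - 1) / real k\<rceil> = q + 1" if "0 < r"
  proof -
    have "real (n - 1) / real k = real q + real r / real k"
      unfolding nqr using k(1) by (simp add: add_divide_distrib)
    moreover have "0 < real r / real k" "real r / real k < 1" using that rk by auto
    moreover have "real_of_int (int q + 1) = real q + 1" by simp
    ultimately have "\<lceil>real (n - 1) / real k\<rceil> = int q + 1"
      by (intro ceiling_unique) linarith+
    then show ?thesis by simp
  qed
  have S: "S = spider as"
    unfolding S_def as_def fl using ce by (cases "r = 0") auto
  define L where "L i = (if i < r then q + 1 else q)" for i
  have len: "length as = k" using rk by (simp add: as_def)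
  have as_nth: "as ! i = L i" if "i < k" for i
    using that rk by (simp add: as_def L_def nth_append)
  interpret S: spider_graph as
    using k as_nth q1 by unfold_locales (auto simp: len L_def)
  have sumL: "(\<Sum>i<k. L i) = n - 1"
  proof -
    have "(\<Sum>i<k. L i) = (\<Sum>i<k. q + (if i < r then 1 else 0))"
      by (intro sum.cong) (auto simp: L_def)
    also have "\<dots> = k * q + (\<Sum>i<k. if i < r then 1 else 0)" by (simp add: sum.distrib)
    also have "(\<Sum>i<k. if i < r then 1 else 0) = card {i \<in> {..<k}. i < r}"
      by (simp add: sum.If_cases Int_def conj_commute)
    also have "{i \<in> {..<k}. i < r} = {..<r}" using rk by auto
    finally show ?thesis using nqr by simp
  qed
  have X: "spider_verts (length as) ((!) as) = spider_verts k L"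
    unfolding len by (rule spider_verts_cong) (rule as_nth)
  have "(\<Sum>i<length as. as ! i) = n - 1" unfolding len sumL[symmetric] using as_nth by simp
  then have "card (pverts (spider as)) = n" using S.card_spider k by simp
  then have S_in: "S \<in> trees_with_leaves n k"
    unfolding S trees_with_leaves_def using S.simple_tree_spider S.card_leaves_spider len by simp
  have S_le: "eccentric_distance_sum S \<le> (\<Sum>x\<in>spider_verts k L. \<Sum>y\<in>spider_verts k L. e x * spider_dist x y)"
    if "\<And>x y. x \<in> spider_verts k L \<Longrightarrow> y \<in> spider_verts k L \<Longrightarrow> spider_dist x y \<le> e x" for e
    using S.eccentric_distance_sum_spider_le[of e] that unfolding S X by blast
  have snd_le: "snd y \<le> q'" if "y \<in> spider_verts k L" for y
    using that by (auto simp: spider_verts_def L_def q'_def split: if_splits)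
  have "eccentric_distance_sum S \<le> eccentric_distance_sum T"
    if T: "T \<in> (trees_with_leaves n k :: 'a pair_pre_digraph set)" for T
  proof -
    have T': "pair_graph T" "Digraph_Component.connected (with_proj T)"
      "\<not> (\<exists>p. pre_digraph.cycle (with_proj T) p \<and> 3 \<le> length p)"
      "card (pverts T) = n" "card (leaves T) = k"
      using T by (auto simp: trees_with_leaves_def simple_tree_def)
    interpret T: simple_tree_graph T
      by (intro simple_tree_graph.intro connected_pair_graph.intro simple_tree_graph_axioms.intro
        connected_pair_graph_axioms.intro T'(1-3))
    obtain l R R' where l: "(\<Sum>i<k. l i) = n - 1" "l 0 = R" "\<And>i. 0 < i \<Longrightarrow> i < k \<Longrightarrow> l i \<le> R'"
      and R: "R' \<le> R" "R \<le> Suc R'"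
      and le: "(\<Sum>x\<in>spider_verts k l. \<Sum>y\<in>spider_verts k l.
        ((if fst x = 0 \<and> snd x > 0 then R' else R) + snd x) * spider_dist x y) \<le> eccentric_distance_sum T"
      using T.spider_lower_bound[OF T'(5)] k(2) unfolding T'(4) by blast
    show ?thesis
    proof (cases "q' \<le> R'")
      case True
      \<comment> \<open>\<open>q'\<close> is the longest leg of \<open>S\<close>, so
        \<open>q'\<close> plus depth bounds its eccentricities; by
        \<open>q' \<le> R' \<le> R\<close> it is also at most every weight of the straightened
        tree.\<close>
      have "eccentric_distance_sum S \<le> spider_weight q' k L"
        unfolding spider_weight_def
      proof (rule S_le)
        fix x y assume "x \<in> spider_verts k L" "y \<in> spider_verts k L"
        then show "spider_dist x y \<le> q' + snd x" using snd_le[of y] by (cases x; cases y) auto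
      qed
      also have "\<dots> \<le> spider_weight q' k l"
        using sumL l(1) by (intro spider_weight_balanced_le) (auto simp: L_def)
      also have "\<dots> \<le> (\<Sum>x\<in>spider_verts k l. \<Sum>y\<in>spider_verts k l.
        ((if fst x = 0 \<and> snd x > 0 then R' else R) + snd x) * spider_dist x y)"
        unfolding spider_weight_def using True R by (intro sum_mono mult_right_mono) auto
      finally show ?thesis using le by simp
    next
      \<comment> \<open>Only a tree whose centre is an edge and \<open>r = 1\<close> remain; counting vertices forces \<open>l = L\<close>.\<close>
      case False
      have split0: "(\<Sum>i<k. f i) = f 0 + (\<Sum>i\<in>{1..<k}. f i)" for f :: "nat \<Rightarrow> nat"
        using k(1) by (simp add: lessThan_atLeast0 sum.atLeast_Suc_lessThan)
      have rest: "(\<Sum>i\<in>{1..<k}. l i) \<le> (k - 1) * R'"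
        using sum_bounded_above[of "{1..<k}" l R'] l(3) by simp
      have kR: "R' + (k - 1) * R' = k * R'" using k(1) by (cases k) auto
      \<comment> \<open>The right side is at most \<open>k * R' + 1\<close>. So
        \<open>R' < q\<close> would leave too little room, and \<open>R' = q\<close> leaves room for
        \<open>r \<le> 1\<close> only.\<close>
      have total: "k * q + r \<le> R + (k - 1) * R'"
        using rest l(1,2) split0[of l] nqr by simp
      have R'q: "R' \<le> q" using False by (auto simp: q'_def split: if_splits)
      have "\<not> R' < q"
      proof
        assume "R' < q"
        then have "k * Suc R' \<le> k * q" by (intro mult_le_mono2) simp
        then have "k * R' + k \<le> R + (k - 1) * R'" using total by simp
        then show False using R(2) kR k(1) by linarith
      qed
      then have R': "R' = q" using R'q by simp
      have r1: "r = 1"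
      proof -
        have "r \<noteq> 0" using False R' by (cases "r = 0") (auto simp: q'_def)
        moreover have "r \<le> 1" using total R(2) kR unfolding R' by linarith
        ultimately show ?thesis by simp
      qed
      have R1: "R = q + 1" using total R kR r1 unfolding R' by linarith
      have "l i = L i" if i: "i < k" for i
      proof (cases "i = 0")
        case True
        then show ?thesis using l(2) R1 r1 by (simp add: L_def)
      next
        case False
        have "(\<Sum>i\<in>{1..<k}. l i) = (\<Sum>i\<in>{1..<k}. L i)"
          using split0[of l] split0[of L] l(1,2) sumL R1 r1 by (simp add: L_def)
        then show ?thesis
        proof (rule sum_mono_inv)
          show "l m \<le> L m" if "m \<in> {1..<k}" for m using l(3)[of m] that R' by (simp add: L_def)
        qed (use False i in auto)
      qed
      then have Xl: "spider_verts k l = spider_verts k L" by (rule spider_verts_cong)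
      have "eccentric_distance_sum S \<le> (\<Sum>x\<in>spider_verts k L. \<Sum>y\<in>spider_verts k L.
        ((if fst x = 0 \<and> snd x > 0 then R' else R) + snd x) * spider_dist x y)"
      proof (rule S_le)
        \<comment> \<open>Only leg 0 has length \<open>q + 1\<close>. A non-hub vertex on it faces
          other legs of length \<open>q\<close>, and the end of its own leg is at most
          \<open>q\<close> away, so the smaller offset \<open>R' = q\<close> suffices there.\<close>
        fix x y assume "x \<in> spider_verts k L" "y \<in> spider_verts k L"
        then show "spider_dist x y \<le> (if fst x = 0 \<and> snd x > 0 then R' else R) + snd x"
          unfolding R' R1 using q1
          by (cases x; cases y) (auto simp: spider_verts_def L_def r1 split: if_splits)
      qed
      then show ?thesis using le unfolding Xl by simp
    qed
  qed
  then show ?thesis using S_in by blast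
qed

end
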